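(* Let $q\in(1,2)$ be a root of a nonzero polynomial with coefficients in $\{-1,0,1\}$. (i) Suppose $q$ has an algebraic conjugate $\alpha$ such that $|\alpha|q<1$. Then $l(q)=0$ and, consequently, $\Lambda(q)$ is dense in $\mathbb{R}$. (ii) Suppose $q$ has a non-real algebraic conjugate $\alpha$ such that $|\alpha|q=1$. Then $l(q)=0$. If, in addition, $q<\sqrt2$ in either of the cases (i) or (ii), then $L(q)=0$.
   Context: For $q\in(1,2)$ let $\Lambda(q)=\{\sum_{k=0}^{n} a_kq^k : a_k\in\{-1,0,1\},\ n\ge1\}$. Let $Y_n(q)=\{\sum_{k=0}^{n} a_kq^k : a_k\in\{0,1\}\}$ and $Y(q)=\bigcup_{n\ge1}Y_n(q)$. The set $Y(q)$ is discrete, and its elements are written in ascending order as $0=y_0(q)<y_1(q)<y_2(q)<\cdots$. Define $l(q)=\liminf_{n\to\infty}(y_{n+1}(q)-y_n(q))$ and $L(q)=\limsup_{n\to\infty}(y_{n+1}(q)-y_n(q))$. The conjugates of an algebraic number $q$ are the complex roots of its minimal polynomial over $\mathbb{Q}$. *)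

theory Defs
  imports "HOL-Analysis.Analysis" "HOL-Computational_Algebra.Computational_Algebra"
begin

definition Lam :: "real \<Rightarrow> real set" where
  "Lam q = {\<Sum>k\<le>n. a k * q ^ k | (a :: nat \<Rightarrow> real) n.
     1 \<le> n \<and> (\<forall>k\<le>n. a k \<in> {-1, 0, 1})}"

definition Yn :: "nat \<Rightarrow> real \<Rightarrow> real set" where
  "Yn n q = {\<Sum>k\<le>n. a k * q ^ k | a :: nat \<Rightarrow> real. \<forall>k\<le>n. a k \<in> {0, 1}}"

definition Yset :: "real \<Rightarrow> real set" where
  "Yset q = (\<Union>n\<in>{1..}. Yn n q)"

text \<open>Well defined for \<open>q > 1\<close>: see \<open>yseq_strict_mono\<close>, \<open>range_yseq\<close> and \<open>yseq_0\<close> below.\<close>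

definition yseq :: "real \<Rightarrow> nat \<Rightarrow> real" where
  "yseq q = (THE f. strict_mono f \<and> range f = Yset q)"

text \<open>The limits are taken in the extended reals, where they always exist.\<close>

definition lgap :: "real \<Rightarrow> ereal" where
  "lgap q = liminf (\<lambda>n. ereal (yseq q (Suc n) - yseq q n))"

definition Lgap :: "real \<Rightarrow> ereal" where
  "Lgap q = limsup (\<lambda>n. ereal (yseq q (Suc n) - yseq q n))"

definition is_rat_minpoly :: "rat poly \<Rightarrow> 'a::field_char_0 \<Rightarrow> bool" where
  "is_rat_minpoly p x \<longleftrightarrow> lead_coeff p = 1 \<and> poly (map_poly of_rat p) x = 0 \<and>
     (\<forall>r. r \<noteq> 0 \<and> poly (map_poly of_rat r) x = 0 \<longrightarrow> degree p \<le> degree r)"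

text \<open>Well defined for algebraic numbers: see \<open>rat_minpoly_unique\<close> below.\<close>

definition rat_minpoly :: "'a::field_char_0 \<Rightarrow> rat poly" where
  "rat_minpoly x = (THE p. is_rat_minpoly p x)"

definition conjugates :: "real \<Rightarrow> complex set" where
  "conjugates q = {z. poly (map_poly of_rat (rat_minpoly q)) z = 0}"

lemma finite_Y_le:
  assumes "q > 1"
  shows "finite {x \<in> Yset q. x \<le> M}"
proof -
  obtain K where K: "M < q ^ K" using assms real_arch_pow by blast
  have "{x \<in> Yset q. x \<le> M} \<subseteq> (\<lambda>S. \<Sum>k\<in>S. q ^ k) ` Pow {..<K}"
  proof
    fix x assume "x \<in> {x \<in> Yset q. x \<le> M}"
    then obtain n and a :: "nat \<Rightarrow> real" where x: "x = (\<Sum>k\<le>n. a k * q ^ k)" "x \<le> M"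
      and a: "\<forall>k\<le>n. a k \<in> {0, 1}"
      by (auto simp: Yset_def Yn_def)
    define S where "S = {k. k \<le> n \<and> a k = 1}"
    have fin: "finite S" by (simp add: S_def)
    have "x = (\<Sum>k\<le>n. if a k = 1 then q ^ k else 0)"
      unfolding x(1) using a by (intro sum.cong) auto
    also have "\<dots> = (\<Sum>k\<in>S. q ^ k)"
      unfolding S_def by (simp add: sum.If_cases Int_def)
    finally have xS: "x = (\<Sum>k\<in>S. q ^ k)" .
    have "k < K" if "k \<in> S" for k
    proof -
      have "q ^ k \<le> x" unfolding xS using assms fin that
        by (intro member_le_sum) auto
      with x(2) K have "q ^ k < q ^ K" by linarith
      with assms show ?thesis by (simp add: power_strict_increasing_iff)
    qed
    then show "x \<in> (\<lambda>S. \<Sum>k\<in>S. q ^ k) ` Pow {..<K}" using xS by blast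
  qed
  then show ?thesis by (rule finite_subset) simp
qed

lemma Y_unbounded:
  assumes "q > 1"
  shows "\<exists>x\<in>Yset q. M < x"
proof -
  obtain K where K: "M < q ^ K" using assms real_arch_pow by blast
  have "q ^ K \<le> q ^ Suc K" using assms by simp
  with K have "M < q ^ Suc K" by linarith
  moreover have "q ^ Suc K \<in> Yn (Suc K) q"
    unfolding Yn_def mem_Collect_eq
    by (rule exI[of _ "\<lambda>k. if k = Suc K then 1 else 0"]) (simp add: if_distrib[of "\<lambda>t. t * _"] cong: if_cong)
  ultimately show ?thesis by (fastforce simp: Yset_def)
qed

lemma zero_in_Y: "0 \<in> Yset q"
  by (auto simp: Yset_def Yn_def intro!: bexI[of _ 1] exI[of _ "\<lambda>_. 0"])

lemma Y_nonneg:
  assumes "q > 1" "x \<in> Yset q"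
  shows "0 \<le> x"
  using assms by (force simp: Yset_def Yn_def intro!: sum_nonneg)

lemma strict_mono_range_unique:
  fixes f g :: "nat \<Rightarrow> real"
  assumes "strict_mono f" "strict_mono g" "range f = range g"
  shows "f = g"
proof -
  have "f n = g n" for n
  proof (induction n rule: less_induct)
    case (less n)
    obtain i where i: "f n = g i" using assms(3) by (metis rangeE rangeI)
    obtain j where j: "g n = f j" using assms(3) by (metis rangeE rangeI)
    have "n \<le> i" using less[of i] i assms(1)
      by (metis linorder_not_le order_less_irrefl strict_mono_less)
    moreover have "n \<le> j" using less[of j] j assms(2)
      by (metis linorder_not_le order_less_irrefl strict_mono_less)
    ultimately show ?case using i j assms(1,2)
      by (metis order_antisym strict_mono_less_eq)
  qed
  then show ?thesis by blast
qed

lemma ex_enumeration: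
  fixes S :: "real set"
  assumes fin: "\<And>M. finite {x \<in> S. x \<le> M}" and unb: "\<And>M. \<exists>x\<in>S. M < x"
  shows "\<exists>f :: nat \<Rightarrow> real. strict_mono f \<and> range f = S"
proof -
  have ex: "\<exists>z\<in>S. M < z \<and> (\<forall>x\<in>S. M < x \<longrightarrow> z \<le> x)" for M
  proof -
    obtain b where b: "b \<in> S" "M < b" using unb by blast
    let ?T = "{x \<in> S. x \<le> b} \<inter> {x. M < x}"
    have T: "finite ?T" "?T \<noteq> {}" using fin b by auto
    have "Min ?T \<in> ?T" using T by (rule Min_in)
    moreover have "Min ?T \<le> x" if "x \<in> S" "M < x" for x
    proof (cases "x \<le> b")
      case True
      with that T show ?thesis by (intro Min_le) auto
    next
      case False
      moreover have "Min ?T \<le> b" using b T by (intro Min_le) auto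
      ultimately show ?thesis by linarith
    qed
    ultimately show ?thesis by blast
  qed
  then obtain g where g: "\<And>M. g M \<in> S" "\<And>M. M < g M" "\<And>M x. x \<in> S \<Longrightarrow> M < x \<Longrightarrow> g M \<le> x"
    by metis
  obtain m where m: "\<And>x. x \<in> S \<Longrightarrow> m < x"
  proof -
    have "\<exists>m. \<forall>x\<in>S. m < x"
    proof (cases "{x \<in> S. x \<le> 0} = {}")
      case True
      then show ?thesis by (metis (mono_tags, lifting) Collect_empty_eq linorder_not_le)
    next
      case False
      have le: "Min {x \<in> S. x \<le> 0} \<le> x" if "x \<in> S" for x
      proof (cases "x \<le> 0")
        case True
        with that fin show ?thesis by (intro Min_le) auto
      next
        case F: False
        have "Min {x \<in> S. x \<le> 0} \<in> {x \<in> S. x \<le> 0}" using fin False by (rule Min_in)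
        with F show ?thesis by simp
      qed
      show ?thesis using le by (intro exI[of _ "Min {x \<in> S. x \<le> 0} - 1"]) force
    qed
    then show ?thesis using that by blast
  qed
  define f where "f n = (g ^^ Suc n) m" for n
  have sm: "strict_mono f"
    by (simp add: strict_mono_Suc_iff f_def g)
  have sub: "range f \<subseteq> S" by (auto simp: f_def g)
  have "x \<in> range f" if x: "x \<in> S" for x
  proof (rule ccontr)
    assume n: "x \<notin> range f"
    have "f k < x" for k
    proof (induction k)
      case 0
      have "f 0 \<le> x" using g(3)[OF x m[OF x]] by (simp add: f_def)
      then show ?case using n by (metis order_less_le rangeI)
    next
      case (Suc k)
      have "f (Suc k) \<le> x" using g(3)[OF x Suc] by (simp add: f_def)
      then show ?case using n by (metis order_less_le rangeI)
    qed
    then have "range f \<subseteq> {z \<in> S. z \<le> x}" using sub by (force intro: less_imp_le)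
    then have "finite (range f)" using fin finite_subset by blast
    then show False using sm strict_mono_imp_inj_on finite_imageD infinite_UNIV_nat by blast
  qed
  with sub sm show ?thesis by blast
qed

lemma yseq_enum:
  assumes "q > 1"
  shows yseq_strict_mono: "strict_mono (yseq q)" and range_yseq: "range (yseq q) = Yset q"
proof -
  have "\<exists>f :: nat \<Rightarrow> real. strict_mono f \<and> range f = Yset q"
    using finite_Y_le[OF assms] Y_unbounded[OF assms] by (rule ex_enumeration)
  then have "\<exists>!f :: nat \<Rightarrow> real. strict_mono f \<and> range f = Yset q"
    by (metis strict_mono_range_unique)
  from theI'[OF this] show "strict_mono (yseq q)" "range (yseq q) = Yset q"
    by (simp_all add: yseq_def)
qed

lemma yseq_0:
  assumes "q > 1"
  shows "yseq q 0 = 0"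
proof -
  obtain n where "yseq q n = 0" using zero_in_Y range_yseq[OF assms] by (metis rangeE)
  then have "yseq q 0 \<le> 0" using yseq_strict_mono[OF assms] by (metis bot_nat_0.extremum strict_mono_less_eq)
  moreover have "0 \<le> yseq q 0" using Y_nonneg[OF assms] range_yseq[OF assms] by blast
  ultimately show ?thesis by simp
qed

lemma map_poly_of_rat_diff:
  "map_poly of_rat (p - r) = (map_poly of_rat p - map_poly of_rat r :: 'a::field_char_0 poly)"
  by (rule poly_eqI) (simp add: coeff_map_poly of_rat_diff)

lemma map_poly_of_rat_smult:
  "map_poly of_rat (smult c p) = (smult (of_rat c) (map_poly of_rat p) :: 'a::field_char_0 poly)"
  by (rule poly_eqI) (simp add: coeff_map_poly of_rat_mult)

lemma rat_minpoly_unique: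
  fixes x :: "'a::field_char_0"
  assumes "p0 \<noteq> 0" "poly (map_poly of_rat p0) x = 0"
  shows "\<exists>!p. is_rat_minpoly p x"
proof (rule ex_ex1I)
  let ?R = "\<lambda>p. p \<noteq> 0 \<and> poly (map_poly of_rat p) x = 0"
  define p where "p = arg_min degree ?R"
  have p: "?R p" "\<And>r. ?R r \<Longrightarrow> degree p \<le> degree r"
    unfolding p_def using arg_min_nat_lemma[of ?R p0 degree] assms by blast+
  have "is_rat_minpoly (smult (inverse (lead_coeff p)) p) x"
    using p by (auto simp: is_rat_minpoly_def map_poly_of_rat_smult)
  then show "\<exists>p. is_rat_minpoly p x" by blast
next
  fix p r assume pr: "is_rat_minpoly p x" "is_rat_minpoly r x"
  show "p = r"
  proof (rule ccontr)
    assume "p \<noteq> r"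
    have "p \<noteq> 0" "r \<noteq> 0" using pr by (auto simp: is_rat_minpoly_def)
    then have deg: "degree p = degree r"
      using pr by (intro order_antisym) (auto simp: is_rat_minpoly_def)
    have "degree p \<le> degree (p - r)"
      using pr \<open>p \<noteq> r\<close> by (auto simp: is_rat_minpoly_def map_poly_of_rat_diff)
    moreover have "degree (p - r) \<le> degree p" using deg by (simp add: degree_diff_le)
    ultimately have "degree (p - r) = degree p" by simp
    moreover have "coeff (p - r) (degree p) = 0"
      using pr deg by (simp add: is_rat_minpoly_def)
    ultimately have "p - r = 0" by (metis leading_coeff_0_iff)
    with \<open>p \<noteq> r\<close> show False by simp
  qed
qed

end

theory Submission
  imports Defs
begin

text \<open>
  Write \<open>psum b A\<close> for the sum of the powers \<open>b ^ k\<close> with \<open>k \<in> A\<close>. The core is: if \<open>1 < b < 2\<close> is an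
  algebraic integer with a conjugate \<open>\<alpha> \<noteq> b\<close> outside the closed unit disc, then the sums \<open>psum b A\<close>
  have arbitrarily small positive differences.

  Suppose that they are separated. Then \<open>\<bar>psum b A - psum b B\<bar> \<le> 1 / (b - 1)\<close> forces
  \<open>\<bar>psum \<alpha> A - psum \<alpha> B\<bar> \<le> 1 / (\<bar>\<alpha>\<bar> - 1)\<close>: a pair violating this can be inserted, rescaled, into any family
  of pairwise violating sets, and so produces arbitrarily many sums in an interval of fixed length.
  Hence, with \<open>\<rho> = 1 / b\<close> and \<open>\<gamma> = 1 / \<alpha>\<close>, the value of a series of powers of \<open>\<rho>\<close> determines the value of the
  same series in \<open>\<gamma>\<close>, which defines a bounded function \<open>\<Phi>\<close>. The overlap of the two branches
  \<open>\<rho> x\<close> and \<open>1 + \<rho> x\<close> makes \<open>\<Phi>\<close> additive along a rotation of an interval. If the rotation is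
  irrational, \<open>\<Phi>\<close> is linear along a dense orbit and \<open>\<gamma> = \<rho>\<close>; otherwise \<open>b\<close> is a multinacci number, and again
  \<open>\<gamma> = \<rho>\<close>.

  The conjugates of \<open>q\<close> have product \<open>\<plusminus>1\<close>, so the hypotheses on the small conjugate yield a further
  conjugate outside the closed unit disc. For \<open>L(q)\<close>, the small differences are built from exponents in a set \<open>S\<close>
  whose complement still has sums with bounded gaps: the even exponents if the argument applies to
  \<open>q\<^sup>2\<close>. It fails only if the conjugates of \<open>q\<^sup>2\<close> are \<open>q\<^sup>2\<close> and \<open>- 1 / q\<^sup>2\<close>, so that \<open>q\<^sup>2\<close> is the golden ratio;
  then \<open>S\<close> consists of the exponents \<open>0\<close> and \<open>1\<close> modulo \<open>4\<close>, and counting gives small differences.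
\<close>

section \<open>Finite sums of powers\<close>

definition psum :: "'a::comm_semiring_1 \<Rightarrow> nat set \<Rightarrow> 'a" where
  "psum z A = (\<Sum>k\<in>A. z ^ k)"

lemma psum_empty [simp]: "psum z {} = 0"
  by (simp add: psum_def)

lemma psum_insert: "finite A \<Longrightarrow> k \<notin> A \<Longrightarrow> psum z (insert k A) = z ^ k + psum z A"
  by (simp add: psum_def)

lemma psum_Un: "finite A \<Longrightarrow> finite B \<Longrightarrow> A \<inter> B = {} \<Longrightarrow> psum z (A \<union> B) = psum z A + psum z B"
  by (simp add: psum_def sum.union_disjoint)

lemma psum_shift: "psum z ((+) m ` A) = z ^ m * psum z A"
  by (simp add: psum_def sum.reindex power_add sum_distrib_left)

lemma psum_scale: "m > 0 \<Longrightarrow> psum z ((*) m ` A) = psum (z ^ m) A"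
  by (simp add: psum_def sum.reindex inj_on_def power_mult)

lemma psum_nonneg: "0 \<le> z \<Longrightarrow> 0 \<le> psum (z::real) A"
  by (simp add: psum_def sum_nonneg)

lemma psum_mono: "0 \<le> z \<Longrightarrow> finite B \<Longrightarrow> A \<subseteq> B \<Longrightarrow> psum (z::real) A \<le> psum z B"
  unfolding psum_def by (intro sum_mono2) auto

lemma psum_lessThan: "z \<noteq> 1 \<Longrightarrow> psum (z::'a::field) {..<n} = (z ^ n - 1) / (z - 1)"
  by (simp add: psum_def geometric_sum)

lemma norm_psum_diff_le:
  fixes z :: complex
  assumes "finite C" "A \<subseteq> C" "B \<subseteq> C"
  shows "norm (psum z A - psum z B) \<le> psum (norm z) C"
proof -
  have "psum z A - psum z B = (\<Sum>k\<in>C. (if k \<in> A then z ^ k else 0) - (if k \<in> B then z ^ k else 0))"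
    using assms by (simp add: psum_def sum_subtractf sum.If_cases Int_absorb1)
  also have "norm \<dots> \<le> (\<Sum>k\<in>C. norm z ^ k)"
    by (intro sum_norm_le) (auto simp: norm_power)
  finally show ?thesis by (simp add: psum_def)
qed

text \<open>Induction on \<open>n\<close>: an exponent \<open>n\<close> of \<open>T\<close> is taken
  exactly when \<open>x\<close> is beyond the reach of the smaller exponents, and the hypothesis on
  \<open>q ^ k\<close> then keeps the remainder nonnegative. So the intervals of length
  \<open>G\<close> that start at the sums leave no hole.\<close>

lemma greedy_psum:
  fixes q G x :: real
  assumes "\<And>k. k \<in> T \<Longrightarrow> q ^ k \<le> G + psum q (T \<inter> {..<k})"
    and "0 \<le> x" "x < G + psum q (T \<inter> {..<n})"
  shows "\<exists>A \<subseteq> T \<inter> {..<n}. psum q A \<le> x \<and> x < psum q A + G"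
  using assms(2,3)
proof (induction n arbitrary: x)
  case 0
  then show ?case by (intro exI[of _ "{}"]) auto
next
  case (Suc n)
  show ?case
  proof (cases "n \<in> T \<and> G + psum q (T \<inter> {..<n}) \<le> x")
    case True
    have eq: "T \<inter> {..<Suc n} = insert n (T \<inter> {..<n})" using True by auto
    have "psum q (T \<inter> {..<Suc n}) = q ^ n + psum q (T \<inter> {..<n})"
      unfolding eq by (rule psum_insert) auto
    then have "0 \<le> x - q ^ n" "x - q ^ n < G + psum q (T \<inter> {..<n})"
      using assms(1)[of n] True Suc.prems by auto
    from Suc.IH[OF this] obtain A where A: "A \<subseteq> T \<inter> {..<n}" "psum q A \<le> x - q ^ n"
      "x - q ^ n < psum q A + G" by blast
    have "psum q (insert n A) = q ^ n + psum q A"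
      using A(1) by (intro psum_insert) (auto intro: finite_subset)
    then show ?thesis using A True by (intro exI[of _ "insert n A"]) auto
  next
    case False
    have "x < G + psum q (T \<inter> {..<n})"
    proof (cases "n \<in> T")
      case False
      then have "T \<inter> {..<Suc n} = T \<inter> {..<n}" by (auto simp: less_Suc_eq)
      then show ?thesis using Suc.prems by simp
    qed (use False in auto)
    from Suc.IH[OF Suc.prems(1) this] obtain A
      where "A \<subseteq> T \<inter> {..<n}" "psum q A \<le> x" "x < psum q A + G" by blast
    then show ?thesis by (intro exI[of _ A]) auto
  qed
qed

text \<open>Pigeonhole: points at mutual distance at least \<open>d\<close> lie in different cells
  of a grid of mesh \<open>d\<close>.\<close>

lemma separated_card_le:
  fixes X :: "real set"
  assumes "0 < d" "finite X" "X \<subseteq> {a..a + R}" "0 \<le> R"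
    and sep: "\<And>x y. x \<in> X \<Longrightarrow> y \<in> X \<Longrightarrow> x < y \<Longrightarrow> d \<le> y - x"
  shows "real (card X) \<le> R / d + 1"
proof -
  define f where "f x = \<lfloor>(x - a) / d\<rfloor>" for x
  have inj: "inj_on f X"
  proof (rule linorder_inj_onI')
    fix x y assume xy: "x \<in> X" "y \<in> X" "x < y"
    have "(x - a + d) / d \<le> (y - a) / d"
      using sep[OF xy] \<open>0 < d\<close> by (intro divide_right_mono) auto
    then have "(x - a) / d + 1 \<le> (y - a) / d"
      using \<open>0 < d\<close> by (simp add: add_divide_distrib)
    then show "f x \<noteq> f y" unfolding f_def by linarith
  qed
  have "f ` X \<subseteq> {0..\<lfloor>R / d\<rfloor>}"
  proof (rule image_subsetI)
    fix x assume "x \<in> X"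
    then have "0 \<le> x - a" "x - a \<le> R" using assms(3) by (auto simp: subset_iff)
    then show "f x \<in> {0..\<lfloor>R / d\<rfloor>}"
      using \<open>0 < d\<close> by (auto simp: f_def intro!: floor_mono divide_right_mono)
  qed
  then have "card (f ` X) \<le> card {0..\<lfloor>R / d\<rfloor>}" by (intro card_mono) auto
  then have "real (card X) \<le> real (nat (\<lfloor>R / d\<rfloor> + 1))"
    by (simp add: card_image[OF inj])
  also have "\<dots> = of_int (\<lfloor>R / d\<rfloor> + 1)"
    using assms(1,4) by (subst of_nat_nat) (auto simp: divide_nonneg_pos add_nonneg_nonneg)
  also have "\<dots> \<le> R / d + 1" by simp
  finally show ?thesis .
qed

section \<open>Conjugates\<close>

abbreviation (input) ipoly :: "int poly \<Rightarrow> 'a::{comm_ring_1,ring_char_0} \<Rightarrow> 'a" where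
  "ipoly f x \<equiv> poly (map_poly of_int f) x"

lemma ipoly_add: "ipoly (f + g) x = ipoly f x + ipoly g (x::'a::{comm_ring_1,ring_char_0})"
proof -
  have "map_poly of_int (f + g) = (map_poly of_int f + map_poly of_int g :: 'a poly)"
    by (rule poly_eqI) (simp add: coeff_map_poly)
  then show ?thesis by simp
qed

lemma ipoly_diff: "ipoly (f - g) x = ipoly f x - ipoly g (x::'a::{comm_ring_1,ring_char_0})"
proof -
  have "map_poly of_int (f - g) = (map_poly of_int f - map_poly of_int g :: 'a poly)"
    by (rule poly_eqI) (simp add: coeff_map_poly)
  then show ?thesis by simp
qed

lemma ipoly_mult: "ipoly (f * g) x = ipoly f x * ipoly g (x::'a::{comm_ring_1,ring_char_0})"
proof -
  have "map_poly of_int (f * g) = (map_poly of_int f * map_poly of_int g :: 'a poly)"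
    by (rule poly_eqI) (simp add: coeff_map_poly coeff_mult)
  then show ?thesis by simp
qed

lemma ipoly_monom: "ipoly (monom c k) x = of_int c * (x::'a::{comm_ring_1,ring_char_0}) ^ k"
  by (simp add: map_poly_monom poly_monom)

lemma ipoly_sum: "ipoly (\<Sum>i\<in>I. f i) x = (\<Sum>i\<in>I. ipoly (f i) (x::'a::{comm_ring_1,ring_char_0}))"
  by (induction I rule: infinite_finite_induct) (auto simp: ipoly_add)

lemma ipoly_of_real: "ipoly f (of_real x :: 'a::{real_algebra_1,comm_ring_1}) = of_real (ipoly f x)"
  by (induction f) (auto simp: map_poly_pCons)

text \<open>Phrased through integer relations, because this is how conjugacy is used: every integer
  relation that holds at \<open>b\<close> carries over to \<open>\<alpha>\<close>. For algebraic
  \<open>b\<close> it means being a root of the minimal polynomial.\<close>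

definition conj_to :: "real \<Rightarrow> complex \<Rightarrow> bool" where
  "conj_to b \<alpha> \<longleftrightarrow> (\<forall>f :: int poly. ipoly f b = 0 \<longrightarrow> ipoly f \<alpha> = 0)"

lemma conj_toD: "conj_to b \<alpha> \<Longrightarrow> ipoly f b = 0 \<Longrightarrow> ipoly f \<alpha> = 0"
  by (simp add: conj_to_def)

lemma ipoly_psum: "ipoly (\<Sum>k\<in>A. monom 1 k) x = psum (x::'a::{comm_ring_1,ring_char_0}) A"
  by (simp add: ipoly_sum ipoly_monom psum_def)

lemma conj_to_psum_eq:
  assumes "conj_to b \<alpha>" "psum b A = psum b B"
  shows "psum \<alpha> A = psum \<alpha> B"
  using conj_toD[OF assms(1), of "(\<Sum>k\<in>A. monom 1 k) - (\<Sum>k\<in>B. monom 1 k)"] assms(2)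
  by (simp add: ipoly_diff ipoly_psum)

section \<open>Separated power sums have close conjugates\<close>

text \<open>Setting for an argument by contradiction: \<open>sep\<close> denies that positive
  differences of sums get arbitrarily small.\<close>

locale separated_sums =
  fixes b :: real and \<alpha> :: complex and d :: real
  assumes b: "1 < b" "b < 2" and conj: "conj_to b \<alpha>" and \<alpha>: "1 < cmod \<alpha>" and d: "0 < d"
    and sep: "\<And>A B. finite A \<Longrightarrow> finite B \<Longrightarrow> psum b A < psum b B \<Longrightarrow> d \<le> psum b B - psum b A"
begin

text \<open>With gap length \<open>c\<close>, greedy approximation by exponents below
  \<open>n\<close> covers the numbers from \<open>0\<close> up to \<open>c * b ^ n\<close>, see
  \<open>c_psum\<close>.\<close>

definition c where "c = 1 / (b - 1)"

text \<open>Chosen for \<open>apart_refine\<close>: sums at \<open>\<alpha>\<close> with exponents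
  below \<open>K\<close> differ by at most \<open>M * (cmod \<alpha> ^ K - 1)\<close>, so a distance
  above \<open>M\<close> survives scaling by \<open>\<alpha> ^ K\<close> together with any choice of
  low digits.\<close>

definition M where "M = 1 / (cmod \<alpha> - 1)"

text \<open>The last condition says that the half-open intervals of length \<open>c\<close> starting at the sums
  \<open>psum b A\<close> have a common point, namely the largest of these sums.\<close>

definition config :: "nat set set \<Rightarrow> bool" where
  "config F \<longleftrightarrow> finite F \<and> (\<forall>A\<in>F. finite A) \<and>
     (\<forall>A\<in>F. \<forall>B\<in>F. A \<noteq> B \<longrightarrow> M < cmod (psum \<alpha> A - psum \<alpha> B)) \<and>
     (\<forall>A\<in>F. \<forall>B\<in>F. psum b A < psum b B + c)"

lemma c_gt_1: "1 < c"
  using b by (simp add: c_def)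

lemma M_pos: "0 < M"
  using \<alpha> by (simp add: M_def)

lemma c_psum: "c + psum b {..<n} = c * b ^ n"
  using b by (simp add: psum_lessThan c_def field_simps)

text \<open>Members with equal sums at \<open>b\<close> would have equal sums at
  \<open>\<alpha>\<close>, which their distance forbids. So the sums at \<open>b\<close> are
  distinct, \<open>d\<close>-separated and confined to an interval of length
  \<open>c\<close>.\<close>

lemma config_card_le:
  assumes "config F"
  shows "real (card F) \<le> c / d + 1"
proof (cases "F = {}")
  case True
  then show ?thesis using c_gt_1 d by simp
next
  case False
  have inj: "inj_on (psum b) F"
  proof (rule inj_onI)
    fix A B assume AB: "A \<in> F" "B \<in> F" "psum b A = psum b B"
    then have "psum \<alpha> A = psum \<alpha> B" using conj_to_psum_eq[OF conj] by blast
    then show "A = B" using assms AB M_pos by (force simp: config_def)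
  qed
  have fin: "finite (psum b ` F)" using assms by (simp add: config_def)
  have "Min (psum b ` F) \<in> psum b ` F" using fin False by (intro Min_in) auto
  then obtain A0 where A0: "A0 \<in> F" "psum b A0 = Min (psum b ` F)" by force
  have "real (card (psum b ` F)) \<le> c / d + 1"
  proof (rule separated_card_le[OF d fin])
    show "psum b ` F \<subseteq> {psum b A0..psum b A0 + c}"
      using assms A0 fin by (force simp: config_def intro: Min_le less_imp_le)
    show "0 \<le> c" using c_gt_1 by simp
  qed (use assms sep in \<open>auto simp: config_def\<close>)
  then show ?thesis by (simp add: card_image[OF inj])
qed

lemma apart_refine:
  assumes "finite A" "finite B" "M < cmod (psum \<alpha> A - psum \<alpha> B)" "E \<subseteq> {..<K}" "E' \<subseteq> {..<K}"
  shows "M < cmod (psum \<alpha> ((+) K ` A \<union> E) - psum \<alpha> ((+) K ` B \<union> E'))"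
proof -
  have fin: "finite E" "finite E'" using assms by (auto intro: finite_subset)
  have "psum \<alpha> ((+) K ` A \<union> E) = \<alpha> ^ K * psum \<alpha> A + psum \<alpha> E"
    using assms fin by (subst psum_Un) (auto simp: psum_shift)
  moreover have "psum \<alpha> ((+) K ` B \<union> E') = \<alpha> ^ K * psum \<alpha> B + psum \<alpha> E'"
    using assms fin by (subst psum_Un) (auto simp: psum_shift)
  ultimately have eq: "psum \<alpha> ((+) K ` A \<union> E) - psum \<alpha> ((+) K ` B \<union> E') =
      \<alpha> ^ K * (psum \<alpha> A - psum \<alpha> B) - (psum \<alpha> E' - psum \<alpha> E)"
    by (simp add: algebra_simps)
  have 1: "cmod (psum \<alpha> E' - psum \<alpha> E) \<le> M * (cmod \<alpha> ^ K - 1)"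
    using norm_psum_diff_le[OF _ assms(5,4), of \<alpha>] \<alpha>
    by (simp add: psum_lessThan M_def)
  have "cmod \<alpha> ^ K * M < cmod \<alpha> ^ K * cmod (psum \<alpha> A - psum \<alpha> B)"
    using assms(3) \<alpha> by (intro mult_strict_left_mono zero_less_power) linarith+
  then have 2: "cmod \<alpha> ^ K * M < cmod (\<alpha> ^ K * (psum \<alpha> A - psum \<alpha> B))"
    by (simp add: norm_mult norm_power)
  show ?thesis unfolding eq using 1 2 norm_triangle_ineq2[of "\<alpha> ^ K * (psum \<alpha> A - psum \<alpha> B)" "psum \<alpha> E' - psum \<alpha> E"]
    by (simp add: algebra_simps)
qed

text \<open>The member \<open>A1\<close> with the largest sum is replaced by two refinements, which carry the digits of \<open>P\<close> and
  \<open>Q\<close> in the low places; the other members are refined greedily so as to stay close.\<close>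

lemma config_extend:
  assumes F: "config F" "F \<noteq> {}" and fin: "finite P" "finite Q"
    and far: "M < cmod (psum \<alpha> P - psum \<alpha> Q)" and near: "\<bar>psum b P - psum b Q\<bar> < c"
  shows "\<exists>F'. config F' \<and> F' \<noteq> {} \<and> card F' = Suc (card F)"
proof -
  have finF: "finite F" "\<And>A. A \<in> F \<Longrightarrow> finite A" using F by (auto simp: config_def)
  have "Max (psum b ` F) \<in> psum b ` F" "Min (psum b ` F) \<in> psum b ` F"
    using finF F by auto
  then obtain A1 A0 where A1: "A1 \<in> F" "psum b A1 = Max (psum b ` F)"
    and A0: "A0 \<in> F" "psum b A0 = Min (psum b ` F)" by force
  define v w where "v = psum b A1" and "w = psum b A0"
  have vw: "w \<le> psum b A" "psum b A \<le> v" if "A \<in> F" for A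
    using that A1 A0 finF by (auto simp: v_def w_def)
  have "v < w + c" using F(1) A0(1) A1(1) unfolding config_def v_def w_def by blast
  obtain m where m: "P \<subseteq> {..<m}" "Q \<subseteq> {..<m}"
  proof -
    obtain m where "\<And>x. x \<in> P \<union> Q \<Longrightarrow> x < m" using fin finite_nat_set_iff_bounded[of "P \<union> Q"] by auto
    then show ?thesis using that[of m] by auto
  qed
  \<comment> \<open>\<open>w + c - v\<close> is the slack in the common intersection of the
    intervals. Scaled by \<open>b ^ K\<close> it exceeds \<open>y\<close>, the room that the digits
    of \<open>P\<close> and \<open>Q\<close> take up.\<close>
  obtain m' where m': "c / (w + c - v) < b ^ m'" using b real_arch_pow by blast
  define K where "K = m' + m"
  define y where "y = max (psum b P) (psum b Q)"
  have y: "0 \<le> y" "y < c * b ^ m"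
  proof -
    show "0 \<le> y" using psum_nonneg[of b P] b by (simp add: y_def)
    have "y \<le> psum b {..<m}" unfolding y_def using m b by (auto intro!: psum_mono)
    then show "y < c * b ^ m" using c_psum[of m] c_gt_1 by linarith
  qed
  have yK: "y < b ^ K * (w + c - v)"
  proof -
    have "c * b ^ m < (w + c - v) * b ^ m' * b ^ m"
      using m' \<open>v < w + c\<close> b by (intro mult_strict_right_mono) (auto simp: field_simps)
    then show ?thesis using y by (simp add: K_def power_add algebra_simps)
  qed
  \<comment> \<open>\<open>x\<close> is the larger of the two refined sums of \<open>A1\<close>.
    Every other member only has to be refined to a sum in the window of length \<open>c\<close> that
    ends at \<open>x\<close>.\<close>
  define x where "x = b ^ K * v + y"
  have "\<exists>E \<subseteq> {..<K}. psum b E \<le> x - b ^ K * psum b A \<and> x - b ^ K * psum b A < psum b E + c"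
    if A: "A \<in> F" for A
  proof -
    have "b ^ K * psum b A \<le> b ^ K * v" "b ^ K * w \<le> b ^ K * psum b A"
      using vw[OF A] b by (auto intro!: mult_left_mono)
    then have x: "0 \<le> x - b ^ K * psum b A" "x - b ^ K * psum b A < c * b ^ K"
      using y yK by (auto simp: x_def algebra_simps)
    have "b ^ k \<le> c + psum b (UNIV \<inter> {..<k})" for k
      using c_psum[of k] c_gt_1 b by simp
    from greedy_psum[of UNIV b c, OF this x(1), of K] x(2) c_psum[of K] show ?thesis by auto
  qed
  then obtain e where e: "\<And>A. A \<in> F \<Longrightarrow> e A \<subseteq> {..<K}"
    "\<And>A. A \<in> F \<Longrightarrow> psum b (e A) \<le> x - b ^ K * psum b A"
    "\<And>A. A \<in> F \<Longrightarrow> x - b ^ K * psum b A < psum b (e A) + c" by metis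
  define g where "g A E = (+) K ` A \<union> E" for A and E :: "nat set"
  have gsum: "psum b (g A E) = b ^ K * psum b A + psum b E" if "A \<in> F" "E \<subseteq> {..<K}" for A E
    unfolding g_def using that finF by (subst psum_Un) (auto simp: psum_shift intro: finite_subset)
  have gapart: "M < cmod (psum \<alpha> (g A E) - psum \<alpha> (g B E'))"
    if "A \<in> F" "B \<in> F" "A \<noteq> B" "E \<subseteq> {..<K}" "E' \<subseteq> {..<K}" for A B E E'
    unfolding g_def using that F finF by (intro apart_refine) (auto simp: config_def)
  have PQ: "P \<subseteq> {..<K}" "Q \<subseteq> {..<K}" using m by (auto simp: K_def)
  have PQapart: "M < cmod (psum \<alpha> (g A1 P) - psum \<alpha> (g A1 Q))"
  proof -
    have "psum \<alpha> (g A1 E) = \<alpha> ^ K * psum \<alpha> A1 + psum \<alpha> E" if "E \<subseteq> {..<K}" for E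
      unfolding g_def using that finF A1 by (subst psum_Un) (auto simp: psum_shift intro: finite_subset)
    then show ?thesis using far PQ by simp
  qed
  define h where "h A = g A (e A)" for A
  define F' where "F' = h ` (F - {A1}) \<union> {g A1 P, g A1 Q}"
  have x1: "psum b D \<le> x \<and> x < psum b D + c" if "D \<in> F'" for D
  proof -
    have "psum b (h A) \<le> x \<and> x < psum b (h A) + c" if "A \<in> F" for A
      using gsum[OF that e(1)[OF that]] e(2,3)[OF that] unfolding h_def by linarith
    moreover have "psum b (g A1 P) = b ^ K * v + psum b P" "psum b (g A1 Q) = b ^ K * v + psum b Q"
      using gsum[OF A1(1)] PQ by (auto simp: v_def)
    then have "psum b (g A1 P) \<le> x \<and> x < psum b (g A1 P) + c" "psum b (g A1 Q) \<le> x \<and> x < psum b (g A1 Q) + c"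
      using near c_gt_1 by (auto simp: x_def y_def max_def)
    ultimately show ?thesis using that by (auto simp: F'_def)
  qed
  have neq: "D \<noteq> D'" if "M < cmod (psum \<alpha> D - psum \<alpha> D')" for D D'
    using that M_pos by auto
  have hP: "M < cmod (psum \<alpha> (h A) - psum \<alpha> (g A1 P))" "M < cmod (psum \<alpha> (h A) - psum \<alpha> (g A1 Q))"
    if "A \<in> F - {A1}" for A
    using that gapart[of A A1] e PQ A1 unfolding h_def by auto
  have hh: "M < cmod (psum \<alpha> (h A) - psum \<alpha> (h B))" if "A \<in> F" "B \<in> F" "A \<noteq> B" for A B
    using that gapart[of A B] e unfolding h_def by auto
  have conf: "config F'"
    unfolding config_def
  proof (intro conjI ballI impI)
    show "finite F'" using finF by (simp add: F'_def)
    show "finite A" if "A \<in> F'" for A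
      using that finF e(1) fin A1 by (auto simp: F'_def h_def g_def intro: finite_subset)
    show "psum b A < psum b B + c" if "A \<in> F'" "B \<in> F'" for A B
      using x1[OF that(1)] x1[OF that(2)] by linarith
    show "M < cmod (psum \<alpha> A - psum \<alpha> B)" if AB: "A \<in> F'" "B \<in> F'" "A \<noteq> B" for A B
    proof -
      define far where "far D D' \<longleftrightarrow> M < cmod (psum \<alpha> D - psum \<alpha> D')" for D D'
      have 1: "far (h A) (h B)" if "A \<in> F" "B \<in> F" "A \<noteq> B" for A B
        using hh that by (simp add: far_def)
      have 2: "far (h A) (g A1 P)" "far (g A1 P) (h A)" "far (h A) (g A1 Q)" "far (g A1 Q) (h A)"
        if "A \<in> F - {A1}" for A
        using hP[OF that] norm_minus_commute[of "psum \<alpha> (h A)"] by (simp_all only: far_def)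
      have 3: "far (g A1 P) (g A1 Q)" "far (g A1 Q) (g A1 P)"
        using PQapart norm_minus_commute[of "psum \<alpha> (g A1 P)"] by (simp_all only: far_def)
      consider A' where "A' \<in> F - {A1}" "A = h A'" | "A = g A1 P" | "A = g A1 Q"
        using AB(1) unfolding F'_def by (elim UnE insertE imageE emptyE)
      note A = this
      consider B' where "B' \<in> F - {A1}" "B = h B'" | "B = g A1 P" | "B = g A1 Q"
        using AB(2) unfolding F'_def by (elim UnE insertE imageE emptyE)
      then have "far A B"
      proof cases
        case B: (1 B')
        show ?thesis
        proof (rule A)
          fix A' assume A': "A' \<in> F - {A1}" "A = h A'"
          then have "A' \<noteq> B'" using B(2) AB(3) by metis
          then show ?thesis using 1[of A' B'] A' B by simp
        qed (use 2[OF B(1)] B(2) in \<open>simp_all only:\<close>)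
      next
        case B: 2
        show ?thesis by (rule A) (use 2 3 B AB(3) in \<open>simp_all only:\<close>)
      next
        case B: 3
        show ?thesis by (rule A) (use 2 3 B AB(3) in \<open>simp_all only:\<close>)
      qed
      then show ?thesis by (simp only: far_def)
    qed
  qed
  have "inj_on h (F - {A1})"
    using hh neq by (intro inj_onI) blast
  then have "card (h ` (F - {A1})) = card F - 1" using A1 finF by (simp add: card_image)
  moreover have "g A1 P \<noteq> g A1 Q" using PQapart neq by blast
  moreover have "g A1 P \<notin> h ` (F - {A1})" "g A1 Q \<notin> h ` (F - {A1})"
    using hP neq by blast+
  moreover have "card F > 0" using F finF by (simp add: card_gt_0_iff)
  ultimately have "card F' = Suc (card F)"
    unfolding F'_def using finF by (simp add: card_insert_if)
  then show ?thesis using conf by (auto simp: F'_def)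
qed

text \<open>Otherwise repeated use of \<open>config_extend\<close> with the same pair, starting from
  the singleton of the empty set, yields configurations of every size, against
  \<open>config_card_le\<close>.\<close>

lemma conj_close_strict:
  assumes "finite P" "finite Q" "\<bar>psum b P - psum b Q\<bar> < c"
  shows "cmod (psum \<alpha> P - psum \<alpha> Q) \<le> M"
proof (rule ccontr)
  assume "\<not> ?thesis"
  then have far: "M < cmod (psum \<alpha> P - psum \<alpha> Q)" by simp
  have "\<exists>F. config F \<and> F \<noteq> {} \<and> card F = Suc n" for n
  proof (induction n)
    case 0
    show ?case using c_gt_1 by (intro exI[of _ "{{}}"]) (auto simp: config_def)
  next
    case (Suc n)
    then show ?case using config_extend[OF _ _ assms(1,2) far assms(3)] by metis
  qed
  then obtain F where "config F" "card F = Suc (nat \<lceil>c / d + 1\<rceil>)" by blast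
  with config_card_le[of F] show False by linarith
qed

text \<open>Only the endpoint is new. A difference equal to \<open>c\<close> is the integer relation
  \<open>(b - 1) * (psum b P - psum b Q) = 1\<close>, which carries over to \<open>\<alpha>\<close>,
  and \<open>cmod (\<alpha> - 1)\<close> is at least \<open>cmod \<alpha> - 1\<close>.\<close>

lemma conj_close:
  assumes "finite P" "finite Q" "\<bar>psum b P - psum b Q\<bar> \<le> c"
  shows "cmod (psum \<alpha> P - psum \<alpha> Q) \<le> M"
proof -
  have eq: "cmod (psum \<alpha> P - psum \<alpha> Q) \<le> M" if "psum b P - psum b Q = c" for P Q
  proof -
    have "(b - 1) * (psum b P - psum b Q) = 1" using that b by (simp add: c_def)
    moreover define f :: "int poly" where "f = (monom 1 1 - monom 1 0) * ((\<Sum>k\<in>P. monom 1 k) - (\<Sum>k\<in>Q. monom 1 k)) - monom 1 0"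
    ultimately have "ipoly f b = 0" by (simp add: f_def ipoly_mult ipoly_diff ipoly_psum ipoly_monom)
    then have "ipoly f \<alpha> = 0" using conj conj_toD by blast
    then have "(\<alpha> - 1) * (psum \<alpha> P - psum \<alpha> Q) = 1"
      by (simp add: f_def ipoly_mult ipoly_diff ipoly_psum ipoly_monom)
    then have 1: "cmod (\<alpha> - 1) * cmod (psum \<alpha> P - psum \<alpha> Q) = 1"
      by (metis norm_mult norm_one)
    have "cmod \<alpha> - 1 \<le> cmod (\<alpha> - 1)" using norm_triangle_ineq2[of \<alpha> 1] by simp
    then have "(cmod \<alpha> - 1) * cmod (psum \<alpha> P - psum \<alpha> Q) \<le> 1"
      using 1 mult_right_mono[of "cmod \<alpha> - 1" "cmod (\<alpha> - 1)" "cmod (psum \<alpha> P - psum \<alpha> Q)"] by simp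
    then show ?thesis using \<alpha> by (simp add: M_def field_simps)
  qed
  consider "\<bar>psum b P - psum b Q\<bar> < c" | "psum b P - psum b Q = c" | "psum b Q - psum b P = c"
    using assms by linarith
  then show ?thesis
  proof cases
    case 3
    then show ?thesis using eq[of Q P] by (simp add: norm_minus_commute)
  qed (use assms eq conj_close_strict in auto)
qed

end

section \<open>Power sums over infinite sets\<close>

definition pseries :: "'a::{real_normed_field,banach} \<Rightarrow> nat set \<Rightarrow> 'a" where
  "pseries z A = (\<Sum>k. of_bool (k \<in> A) * z ^ k)"

lemma summable_pseries:
  fixes z :: "'a::{real_normed_field,banach}"
  assumes "norm z < 1"
  shows "summable (\<lambda>k. of_bool (k \<in> A) * z ^ k)"
proof (rule summable_comparison_test)
  show "\<exists>N. \<forall>k\<ge>N. norm (of_bool (k \<in> A) * z ^ k) \<le> norm z ^ k"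
    by (auto simp: norm_power norm_mult)
  show "summable (\<lambda>k. norm z ^ k)" using assms by (simp add: summable_geometric)
qed

lemma pseries_split:
  fixes z :: "'a::{real_normed_field,banach}"
  assumes "norm z < 1"
  shows "pseries z A = psum z (A \<inter> {..<n}) + z ^ n * pseries z {k. n + k \<in> A}"
proof -
  have "pseries z A = (\<Sum>k. of_bool (k + n \<in> A) * z ^ (k + n)) + (\<Sum>k<n. of_bool (k \<in> A) * z ^ k)"
    unfolding pseries_def by (rule suminf_split_initial_segment[OF summable_pseries[OF assms]])
  also have "(\<Sum>k. of_bool (k + n \<in> A) * z ^ (k + n)) = (\<Sum>k. z ^ n * (of_bool (k \<in> {k. n + k \<in> A}) * z ^ k))"
    by (intro suminf_cong) (simp add: power_add add.commute)
  also have "\<dots> = z ^ n * pseries z {k. n + k \<in> A}"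
    unfolding pseries_def by (rule suminf_mult[OF summable_pseries[OF assms]])
  also have "(\<Sum>k<n. of_bool (k \<in> A) * z ^ k) = psum z (A \<inter> {..<n})"
    unfolding psum_def by (simp add: of_bool_def if_distrib[of "\<lambda>t. t * _"] sum.If_cases Int_def conj_commute cong: if_cong)
  finally show ?thesis by simp
qed

lemma pseries_append:
  fixes z :: "'a::{real_normed_field,banach}"
  assumes "norm z < 1" "F \<subseteq> {..<m}"
  shows "pseries z (F \<union> (+) m ` A) = psum z F + z ^ m * pseries z A"
proof -
  have "(F \<union> (+) m ` A) \<inter> {..<m} = F" "{k. m + k \<in> F \<union> (+) m ` A} = A"
    using assms(2) by auto
  then show ?thesis using pseries_split[OF assms(1), of "F \<union> (+) m ` A" m] by simp
qed

lemma norm_pseries_le: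
  fixes z :: "'a::{real_normed_field,banach}"
  assumes "norm z < 1"
  shows "norm (pseries z A) \<le> 1 / (1 - norm z)"
proof -
  have "norm (pseries z A) \<le> (\<Sum>k. norm z ^ k)"
    unfolding pseries_def
  proof (rule norm_suminf_le)
    show "norm (of_bool (k \<in> A) * z ^ k) \<le> norm z ^ k" for k
      by (auto simp: norm_power norm_mult)
    show "summable (\<lambda>k. norm z ^ k)" using assms by (simp add: summable_geometric)
  qed
  then show ?thesis using assms by (simp add: suminf_geometric)
qed

lemma pseries_nonneg:
  assumes "0 \<le> z" "z < (1::real)"
  shows "0 \<le> pseries z A"
  unfolding pseries_def using assms by (intro suminf_nonneg summable_pseries) auto

lemma nonpos_if_le_geometric:
  fixes a K r :: real
  assumes "\<And>n::nat. a \<le> K * r ^ n" "0 \<le> r" "r < 1"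
  shows "a \<le> 0"
proof -
  have "(\<lambda>n. K * r ^ n) \<longlonglongrightarrow> K * 0"
    using assms by (intro tendsto_intros LIMSEQ_realpow_zero)
  then show ?thesis using assms(1) by (intro LIMSEQ_le_const[of _ "K * 0" a, simplified]) auto
qed

text \<open>Greedy expansion in base \<open>b\<close>: \<open>xs n\<close> is the remainder after
  \<open>n\<close> digits, scaled by \<open>b ^ n\<close>, and a digit \<open>1\<close> is emitted
  when it is at least \<open>1\<close>. The remainders stay bounded, so the partial sums converge to
  \<open>x\<close>.\<close>

lemma ex_pseries_expansion:
  fixes b x :: real
  assumes b: "1 < b" "b \<le> 2" and x: "0 \<le> x" "x \<le> b / (b - 1)"
  shows "\<exists>A. pseries (1 / b) A = x"
proof -
  define xs where "xs = rec_nat x (\<lambda>_ y. if 1 \<le> y then b * (y - 1) else b * y)"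
  define A where "A = {n. 1 \<le> xs n}"
  have xs0: "xs 0 = x" and xsS: "xs (Suc n) = (if 1 \<le> xs n then b * (xs n - 1) else b * xs n)" for n
    by (simp_all add: xs_def)
  have bounds: "0 \<le> xs n \<and> xs n \<le> b / (b - 1)" for n
  proof (induction n)
    case 0
    then show ?case using x by (simp add: xs0)
  next
    case (Suc n)
    have 1: "b * (b / (b - 1) - 1) = b / (b - 1)" using b by (simp add: field_simps)
    have 2: "b * (xs n - 1) \<le> b * (b / (b - 1) - 1)" using Suc b by (intro mult_left_mono) auto
    \<comment> \<open>Here \<open>b \<le> 2\<close> enters: a remainder below \<open>1\<close> stays
      in range when multiplied by \<open>b\<close>.\<close>
    have 3: "b \<le> b / (b - 1)"
    proof -
      have "b * (b - 1) \<le> b * 1" using b by (intro mult_left_mono) auto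
      then show ?thesis using b by (simp add: pos_le_divide_eq)
    qed
    have 4: "b * xs n \<le> b / (b - 1)" if "\<not> 1 \<le> xs n"
    proof -
      have "b * xs n \<le> b * 1" using that b by (intro mult_left_mono) auto
      with 3 show ?thesis by simp
    qed
    show ?case using Suc b 1 2 3 4 by (auto simp: xsS)
  qed
  have eq: "x = psum (1 / b) (A \<inter> {..<n}) + (1 / b) ^ n * xs n" for n
  proof (induction n)
    case 0
    then show ?case by (simp add: xs0)
  next
    case (Suc n)
    show ?case
    proof (cases "n \<in> A")
      case True
      then have "A \<inter> {..<Suc n} = insert n (A \<inter> {..<n})" by auto
      then have "psum (1 / b) (A \<inter> {..<Suc n}) = (1 / b) ^ n + psum (1 / b) (A \<inter> {..<n})"
        by (simp add: psum_insert)
      moreover have "(1 / b) ^ Suc n * xs (Suc n) = (1 / b) ^ n * (xs n - 1)"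
        using True b by (simp add: xsS A_def)
      ultimately show ?thesis using Suc by (simp add: algebra_simps)
    next
      case False
      then have "A \<inter> {..<Suc n} = A \<inter> {..<n}" by (auto simp: less_Suc_eq)
      moreover have "(1 / b) ^ Suc n * xs (Suc n) = (1 / b) ^ n * xs n"
        using False b by (simp add: xsS A_def)
      ultimately show ?thesis using Suc by simp
    qed
  qed
  have nb: "norm (1 / b) < 1" using b by simp
  define C where "C = b / (b - 1) + 1 / (1 - norm (1 / b))"
  have "\<bar>x - pseries (1 / b) A\<bar> \<le> C * (1 / b) ^ n" for n
  proof -
    have "x - pseries (1 / b) A = (1 / b) ^ n * (xs n - pseries (1 / b) {k. n + k \<in> A})"
      using eq[of n] pseries_split[OF nb, of A n] by (simp add: algebra_simps)
    moreover have "\<bar>xs n - pseries (1 / b) {k. n + k \<in> A}\<bar> \<le> C"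
      using norm_pseries_le[OF nb, of "{k. n + k \<in> A}"] bounds[of n] unfolding C_def real_norm_def by linarith
    ultimately show ?thesis using b by (simp add: abs_mult mult.commute mult_right_mono)
  qed
  then have "\<bar>x - pseries (1 / b) A\<bar> \<le> 0"
    using b by (intro nonpos_if_le_geometric[of _ C "1 / b"]) auto
  then show ?thesis by (intro exI[of _ A]) simp
qed

text \<open>Reversing the first \<open>n + 1\<close> digits turns a truncated expansion in powers of
  \<open>1 / z\<close> into a finite sum of powers of \<open>z\<close>, the form to which
  \<open>conj_close\<close> applies.\<close>

lemma psum_reflect:
  fixes z :: "'a::field"
  assumes "z \<noteq> 0"
  shows "psum z ((\<lambda>k. n - k) ` (A \<inter> {..<Suc n})) = z ^ n * psum (1 / z) (A \<inter> {..<Suc n})"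
proof -
  have "inj_on (\<lambda>k. n - k) (A \<inter> {..<Suc n})" by (auto simp: inj_on_def)
  then have "psum z ((\<lambda>k. n - k) ` (A \<inter> {..<Suc n})) = (\<Sum>k\<in>A \<inter> {..<Suc n}. z ^ (n - k))"
    by (simp add: psum_def sum.reindex)
  also have "\<dots> = (\<Sum>k\<in>A \<inter> {..<Suc n}. z ^ n * (1 / z) ^ k)"
    using assms by (intro sum.cong) (auto simp: power_diff power_one_over field_simps)
  finally show ?thesis by (simp add: psum_def sum_distrib_left)
qed

context separated_sums
begin

lemma norms_lt_1: "norm (1 / b) < 1" "norm (1 / \<alpha>) < 1" "\<alpha> \<noteq> 0"
  using b \<alpha> by (auto simp: norm_divide divide_less_eq)

text \<open>Truncate both series after digit \<open>n\<close> and reflect. At \<open>b\<close> the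
  finite sums differ only by the tails, so \<open>conj_close\<close> bounds their difference at
  \<open>\<alpha>\<close> by \<open>M\<close>; undoing the reflection divides this by
  \<open>\<alpha> ^ n\<close>. The tails at \<open>1 / \<alpha>\<close> are of the same
  order.\<close>

lemma pseries_conj_eq:
  assumes "pseries (1 / b) A = pseries (1 / b) B"
  shows "pseries (1 / \<alpha>) A = pseries (1 / \<alpha>) B"
proof -
  define g where "g = norm (1 / \<alpha>)"
  have g: "0 < g" "g < 1" using norms_lt_1 by (auto simp: g_def)
  define D where "D = M + 2 / (1 - g)"
  have "cmod (pseries (1 / \<alpha>) A - pseries (1 / \<alpha>) B) \<le> D * g ^ n" for n
  proof -
    define A' B' where "A' = A \<inter> {..<Suc n}" and "B' = B \<inter> {..<Suc n}"
    define A'' B'' where "A'' = {k. Suc n + k \<in> A}" and "B'' = {k. Suc n + k \<in> B}"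
    define P Q where "P = (\<lambda>k. n - k) ` A'" and "Q = (\<lambda>k. n - k) ` B'"
    have fin: "finite P" "finite Q" by (auto simp: P_def Q_def A'_def B'_def)
    have "psum b P - psum b Q = b ^ n * (psum (1 / b) A' - psum (1 / b) B')"
      using psum_reflect[of b n A] psum_reflect[of b n B] b
      by (simp add: P_def Q_def A'_def B'_def algebra_simps)
    also have "psum (1 / b) A' - psum (1 / b) B' = (1 / b) ^ Suc n * (pseries (1 / b) B'' - pseries (1 / b) A'')"
      using assms pseries_split[OF norms_lt_1(1), of A "Suc n"] pseries_split[OF norms_lt_1(1), of B "Suc n"]
      unfolding A'_def B'_def A''_def B''_def by (simp add: algebra_simps)
    also have "b ^ n * \<dots> = (1 / b) * (pseries (1 / b) B'' - pseries (1 / b) A'')"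
      using b by (simp add: power_one_over)
    finally have 1: "psum b P - psum b Q = (1 / b) * (pseries (1 / b) B'' - pseries (1 / b) A'')" .
    have le: "0 \<le> pseries (1 / b) X" "pseries (1 / b) X \<le> 1 / (1 - 1 / b)" for X
      using norm_pseries_le[OF norms_lt_1(1), of X] pseries_nonneg[of "1 / b" X] b by auto
    have "\<bar>pseries (1 / b) B'' - pseries (1 / b) A''\<bar> \<le> 1 / (1 - 1 / b)"
      using le[of A''] le[of B''] by linarith
    \<comment> \<open>The tails can differ by exactly the amount that makes this bound equal to
      \<open>c\<close>, so the closed inequality in \<open>conj_close\<close> is the right
      one.\<close>
    then have "\<bar>psum b P - psum b Q\<bar> \<le> (1 / b) * (1 / (1 - 1 / b))"
      unfolding 1 abs_mult using b by (intro mult_mono) auto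
    also have "\<dots> = c" using b by (simp add: c_def field_simps)
    finally have "cmod (psum \<alpha> P - psum \<alpha> Q) \<le> M" using fin by (intro conj_close)
    moreover have "psum \<alpha> P - psum \<alpha> Q = \<alpha> ^ n * (psum (1 / \<alpha>) A' - psum (1 / \<alpha>) B')"
      using psum_reflect[of \<alpha> n A] psum_reflect[of \<alpha> n B] norms_lt_1
      by (simp add: P_def Q_def A'_def B'_def algebra_simps)
    ultimately have "cmod \<alpha> ^ n * cmod (psum (1 / \<alpha>) A' - psum (1 / \<alpha>) B') \<le> M"
      by (simp add: norm_mult norm_power)
    then have "g ^ n * (cmod \<alpha> ^ n * cmod (psum (1 / \<alpha>) A' - psum (1 / \<alpha>) B')) \<le> g ^ n * M"
      using g by (intro mult_left_mono) auto
    moreover have "g ^ n * cmod \<alpha> ^ n = 1"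
      using norms_lt_1 by (simp add: g_def norm_divide power_one_over)
    ultimately have 2: "cmod (psum (1 / \<alpha>) A' - psum (1 / \<alpha>) B') \<le> M * g ^ n"
      by (simp add: mult.assoc[symmetric] mult.commute)
    have 3: "pseries (1 / \<alpha>) A - pseries (1 / \<alpha>) B = (psum (1 / \<alpha>) A' - psum (1 / \<alpha>) B')
       + (1 / \<alpha>) ^ Suc n * (pseries (1 / \<alpha>) A'' - pseries (1 / \<alpha>) B'')"
      using pseries_split[OF norms_lt_1(2), of A "Suc n"] pseries_split[OF norms_lt_1(2), of B "Suc n"]
      unfolding A'_def B'_def A''_def B''_def by (simp add: algebra_simps)
    have "cmod (pseries (1 / \<alpha>) A'' - pseries (1 / \<alpha>) B'') \<le> 1 / (1 - g) + 1 / (1 - g)"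
      unfolding g_def using norm_pseries_le[OF norms_lt_1(2)] by (intro norm_triangle_le_diff add_mono)
    then have "cmod ((1 / \<alpha>) ^ Suc n * (pseries (1 / \<alpha>) A'' - pseries (1 / \<alpha>) B'')) \<le> g ^ n * (2 / (1 - g))"
      unfolding norm_mult norm_power g_def[symmetric] using g
      by (intro mult_mono) (auto intro: power_decreasing mult_left_le_one_le)
    then show ?thesis unfolding 3 D_def using 2 norm_triangle_ineq order_trans
      by (smt (verit) distrib_right mult.commute)
  qed
  then have "cmod (pseries (1 / \<alpha>) A - pseries (1 / \<alpha>) B) \<le> 0"
    using g by (intro nonpos_if_le_geometric[of _ D g]) auto
  then show ?thesis by simp
qed

end

section \<open>Smallness of differences in the presence of a large conjugate\<close>

text \<open>The triangle inequality gives sum at least \<open>1\<close> at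
  \<open>g = cmod \<gamma>\<close>. Multiplying the equation by \<open>1 - \<gamma>\<close> gives
  \<open>2 * \<gamma> = 1 + \<gamma> ^ Suc n\<close>, and taking norms there gives sum at most
  \<open>1\<close>. Hence \<open>g = \<rho>\<close> by monotonicity, and equality in the triangle
  inequality makes \<open>\<gamma>\<close> a nonnegative real.\<close>

lemma multinacci_reciprocal_unique:
  fixes \<gamma> :: complex and \<rho> :: real
  assumes "1 \<le> n" "0 < \<rho>" "psum \<rho> {1..<Suc n} = 1" "cmod \<gamma> < 1" "psum \<gamma> {1..<Suc n} = 1"
  shows "\<gamma> = of_real \<rho>"
proof -
  define g where "g = cmod \<gamma>"
  have g: "0 \<le> g" "g < 1" using assms by (auto simp: g_def)
  have geo: "(1 - z) * psum z {1..<Suc n} = z - z ^ Suc n" for z :: "'a::field"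
    unfolding psum_def using sum_gp_multiplied[of 1 n z] assms(1) atLeastLessThanSuc_atLeastAtMost[of 1 n] by simp
  have "cmod (psum \<gamma> {1..<Suc n}) \<le> psum g {1..<Suc n}"
    unfolding psum_def g_def by (intro sum_norm_le) (auto simp: norm_power)
  then have ge: "1 \<le> psum g {1..<Suc n}" using assms by simp
  have "2 * \<gamma> = 1 + \<gamma> ^ Suc n" using geo[of \<gamma>] assms(5) by (simp add: algebra_simps)
  then have "2 * g = cmod (1 + \<gamma> ^ Suc n)" unfolding g_def by (metis norm_mult norm_numeral)
  also have "\<dots> \<le> 1 + g ^ Suc n" unfolding g_def by (metis norm_one norm_power norm_triangle_ineq)
  finally have "(1 - g) * psum g {1..<Suc n} \<le> (1 - g) * 1" using geo[of g] by simp
  then have "psum g {1..<Suc n} = 1" using g ge by (auto simp: mult_le_cancel_left)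
  have strict: "psum u {1..<Suc n} < psum v {1..<Suc n}" if "0 \<le> u" "u < v" for u v :: real
    unfolding psum_def using that assms(1)
    by (intro sum_strict_mono power_strict_mono) auto
  have "g = \<rho>"
    using strict[of g \<rho>] strict[of \<rho> g] assms g \<open>psum g _ = 1\<close> by (metis less_irrefl linorder_less_linear less_imp_le)
  have "(\<Sum>k\<in>{1..<Suc n}. g ^ k - Re (\<gamma> ^ k)) = 0"
    using \<open>psum g _ = 1\<close> arg_cong[OF assms(5), of Re] by (simp add: psum_def sum_subtractf del: sum.op_ivl_Suc)
  moreover have "0 \<le> g ^ k - Re (\<gamma> ^ k)" for k
    unfolding g_def using complex_Re_le_cmod[of "\<gamma> ^ k"] by (simp add: norm_power)
  ultimately have "\<forall>k\<in>{1..<Suc n}. g ^ k - Re (\<gamma> ^ k) = 0"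
    by (subst sum_nonneg_eq_0_iff[symmetric]) auto
  then have "Re \<gamma> = cmod \<gamma>" using assms(1) by (auto simp: g_def dest!: bspec[of _ _ 1])
  moreover from this have "Im \<gamma> = 0" using cmod_power2[of \<gamma>] by simp
  ultimately have "\<gamma> = of_real (cmod \<gamma>)" by (intro complex_eqI) simp_all
  then show ?thesis using \<open>g = \<rho>\<close> by (simp add: g_def)
qed

text \<open>\<open>int_rat\<close> says that the ring generated by \<open>b\<close> meets the
  rationals only in the integers. It settles the case of a rational rotation number.\<close>

locale separated_sums_large_conj = separated_sums +
  assumes ne: "\<alpha> \<noteq> of_real b"
    and int_rat: "\<And>f :: int poly. ipoly f b \<in> \<rat> \<Longrightarrow> ipoly f b \<in> \<int>"
begin

definition \<rho> where "\<rho> = 1 / b"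
definition \<gamma> where "\<gamma> = 1 / \<alpha>"
text \<open>The value of the full series in \<open>\<rho>\<close>, hence the right end of the
  interval of represented numbers.\<close>

definition l where "l = b / (b - 1)"
text \<open>By \<open>pseries_conj_eq\<close> the choice of the expansion does not matter. Where no
  expansion exists the value is arbitrary, but it is still a series in \<open>\<gamma>\<close> and
  so obeys the same bound.\<close>

definition \<Phi> where "\<Phi> x = pseries \<gamma> (SOME A. pseries \<rho> A = x)"

lemma \<rho>: "0 < \<rho>" "\<rho> < 1" "norm \<rho> < 1"
  using b by (auto simp: \<rho>_def)

lemma \<gamma>: "norm \<gamma> < 1" "\<gamma> \<noteq> 0"
  using norms_lt_1 by (auto simp: \<gamma>_def)

lemma \<Phi>_pseries: "\<Phi> (pseries \<rho> A) = pseries \<gamma> A"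
proof -
  have "pseries \<rho> (SOME B. pseries \<rho> B = pseries \<rho> A) = pseries \<rho> A" by (rule someI) simp
  then show ?thesis unfolding \<Phi>_def \<gamma>_def \<rho>_def by (rule pseries_conj_eq)
qed

lemma norm_\<Phi>_le: "cmod (\<Phi> x) \<le> 1 / (1 - cmod \<gamma>)"
  unfolding \<Phi>_def by (rule norm_pseries_le[OF \<gamma>(1)])

lemma \<Phi>_append:
  assumes "F \<subseteq> {..<m}" "0 \<le> x" "x \<le> l"
  shows "\<Phi> (psum \<rho> F + \<rho> ^ m * x) = psum \<gamma> F + \<gamma> ^ m * \<Phi> x"
proof -
  obtain A where A: "pseries \<rho> A = x"
    using ex_pseries_expansion[of b x] b assms by (auto simp: \<rho>_def l_def)
  have "\<Phi> (pseries \<rho> (F \<union> (+) m ` A)) = pseries \<gamma> (F \<union> (+) m ` A)" by (rule \<Phi>_pseries)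
  then show ?thesis
    using pseries_append[OF \<rho>(3) assms(1), of A] pseries_append[OF \<gamma>(1) assms(1), of A] \<Phi>_pseries[of A] A
    by simp
qed

text \<open>The bound on \<open>x\<close> lets it be expanded with digits from position
  \<open>m\<close> on, which do not collide with \<open>F\<close>.\<close>

lemma \<Phi>_translate:
  assumes "F \<subseteq> {..<m}" "0 \<le> x" "x \<le> \<rho> ^ m * l"
  shows "\<Phi> (psum \<rho> F + x) = psum \<gamma> F + \<Phi> x"
proof -
  define y where "y = x / \<rho> ^ m"
  have y: "0 \<le> y" "y \<le> l" "x = \<rho> ^ m * y"
    using assms \<rho> by (auto simp: y_def pos_divide_le_eq mult.commute)
  show ?thesis using \<Phi>_append[OF assms(1) y(1,2)] \<Phi>_append[of "{}" m, OF _ y(1,2)] y(3) by simp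
qed

text \<open>Near \<open>0\<close>, translation by \<open>s\<close> and by \<open>e\<close> changes
  \<open>\<Phi>\<close> by constants. Modulo \<open>s\<close>, translation by \<open>e\<close> is a
  rotation of the interval from \<open>0\<close> to \<open>s\<close>, and along it
  \<open>\<Phi>\<close> minus a linear function changes by a constant, which boundedness forces to
  be \<open>0\<close>.\<close>

lemma contradiction: False
proof -
  have \<rho>l: "\<rho> * l = c" using b by (simp add: \<rho>_def l_def c_def)
  have l: "l = c + 1" "1 < l" using b by (auto simp: l_def c_def field_simps)
  have tau: "0 < c - 1" using c_gt_1 by simp
  \<comment> \<open>The two inequalities are exactly what puts \<open>e\<close> between
    \<open>0\<close> and \<open>s\<close>: since \<open>\<rho> ^ Suc n * l = c * s\<close>, they
    read \<open>c * s \<le> c - 1\<close> and \<open>c - 1 < (c + 1) * s\<close>.\<close>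
  obtain n where n: "1 \<le> n" "\<rho> ^ Suc n * l \<le> c - 1" "c - 1 < \<rho> ^ n * l"
  proof -
    obtain N where N: "\<rho> ^ N < (c - 1) / l" using real_arch_pow_inv[of "(c - 1) / l" \<rho>] \<rho> tau l by auto
    define N0 where "N0 = (LEAST N. \<rho> ^ N * l \<le> c - 1)"
    have "\<rho> ^ N * l \<le> c - 1" using N l by (simp add: field_simps)
    then have N0: "\<rho> ^ N0 * l \<le> c - 1" unfolding N0_def by (rule LeastI)
    have N0_0: "N0 \<noteq> 0"
    proof
      assume "N0 = 0"
      with N0 l show False by simp
    qed
    have "N0 \<noteq> 1"
    proof
      assume "N0 = 1"
      with N0 \<rho>l show False by simp
    qed
    with N0_0 obtain n where n: "N0 = Suc n" "1 \<le> n" by (cases N0) auto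
    have "\<not> \<rho> ^ n * l \<le> c - 1" using not_less_Least[of n "\<lambda>N. \<rho> ^ N * l \<le> c - 1"] n by (simp add: N0_def)
    then show ?thesis using that[of n] n N0 by auto
  qed
  define s where "s = \<rho> ^ n"
  have s: "0 < s" "s < 1" using \<rho> n(1) by (auto simp: s_def power_less_one_iff)
  have \<rho>S: "\<rho> ^ Suc n * l = c * s" using \<rho>l by (simp add: s_def mult.commute mult.assoc)
  have cs: "s < c * s" using c_gt_1 s by simp
  have geo: "(1 - z) * psum z {1..<Suc n} = z - z ^ Suc n" for z :: "'a::field"
    unfolding psum_def using sum_gp_multiplied[of 1 n z] n(1) atLeastLessThanSuc_atLeastAtMost[of 1 n] by simp
  define e where "e = psum \<rho> {1..<Suc n} - 1"
  have psum_\<rho>: "psum \<rho> {1..<Suc n} = c - c * s"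
  proof -
    have "(1 - \<rho>) * (c - c * s) = \<rho> - \<rho> * s" using b by (simp add: \<rho>_def c_def field_simps)
    then have "(1 - \<rho>) * psum \<rho> {1..<Suc n} = (1 - \<rho>) * (c - c * s)" using geo[of \<rho>] by (simp add: s_def)
    then show ?thesis using \<rho> by simp
  qed
  have e: "e = c - c * s - 1" by (simp only: e_def psum_\<rho>)
  have e0: "0 \<le> e" using n(2) \<rho>S by (simp add: e)
  have es: "e < s" using n(3) l by (simp add: e s_def algebra_simps)
  define k where "k = psum \<gamma> {1..<Suc n} - 1"
  \<comment> \<open>\<open>s\<close> shifts the digit \<open>n\<close>; \<open>e\<close> exchanges the leading digit \<open>1\<close> for the \<open>n\<close> digits after it.\<close>
  have shift_s: "\<Phi> (x + s) = \<Phi> x + \<gamma> ^ n" if "0 \<le> x" "x \<le> c * s" for x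
  proof -
    have "x \<le> \<rho> ^ Suc n * l" using that by (simp only: \<rho>S)
    then have "\<Phi> (psum \<rho> {n} + x) = psum \<gamma> {n} + \<Phi> x"
      using that by (intro \<Phi>_translate[of _ "Suc n"]) auto
    then show ?thesis by (simp add: psum_def s_def add.commute)
  qed
  have shift_e: "\<Phi> (x + e) = \<Phi> x + k" if x: "0 \<le> x" "x \<le> c * s" for x
  proof -
    have "x \<le> \<rho> ^ Suc n * l" using x by (simp only: \<rho>S)
    then have "\<Phi> (psum \<rho> {1..<Suc n} + x) = psum \<gamma> {1..<Suc n} + \<Phi> x"
      using x by (intro \<Phi>_translate[of _ "Suc n"]) auto
    moreover have "\<Phi> (psum \<rho> {0} + (x + e)) = psum \<gamma> {0} + \<Phi> (x + e)"
      using x e0 e \<rho>l by (intro \<Phi>_translate[of _ 1]) auto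
    ultimately show ?thesis by (simp add: e_def k_def psum_def algebra_simps)
  qed
  \<comment> \<open>The slope for which \<open>h\<close> is unchanged by the translation by
    \<open>s\<close>, so that \<open>h\<close> is compatible with reduction modulo
    \<open>s\<close>.\<close>
  define \<kappa> where "\<kappa> = \<gamma> ^ n / of_real s"
  define h where "h x = \<Phi> x - \<kappa> * of_real x" for x
  define rot where "rot x = (if x + e < s then x + e else x + e - s)" for x
  have rot_range: "0 \<le> rot x \<and> rot x < s" if "0 \<le> x" "x < s" for x
    using that e0 es by (auto simp: rot_def)
  have rot_h: "h (rot x) = h x + (k - \<kappa> * of_real e)" if x: "0 \<le> x" "x < s" for x
  proof -
    have E: "\<Phi> (x + e) = \<Phi> x + k" by (rule shift_e) (use x cs in linarith)+
    have sk: "\<kappa> * of_real s = \<gamma> ^ n" using s by (simp add: \<kappa>_def)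
    show ?thesis
    proof (cases "x + e < s")
      case True
      then show ?thesis using E by (simp add: rot_def h_def algebra_simps)
    next
      case False
      then have "\<Phi> (x + e - s + s) = \<Phi> (x + e - s) + \<gamma> ^ n" by (intro shift_s) (use x es cs in linarith)+
      then have "\<Phi> (x + e - s) = \<Phi> x + k - \<gamma> ^ n" using E by simp
      then show ?thesis using False sk by (simp add: rot_def h_def algebra_simps)
    qed
  qed
  \<comment> \<open>At this starting point \<open>\<Phi>\<close> is known to be
    \<open>\<gamma> ^ Suc n\<close>, while the linear function has the value
    \<open>\<gamma> ^ n * \<rho>\<close>; equality of the two gives
    \<open>\<gamma> = \<rho>\<close>.\<close>
  define x0 where "x0 = \<rho> ^ Suc n"
  have x0: "0 \<le> x0" "x0 < s" "x0 = \<rho> * s" using \<rho> by (auto simp: x0_def s_def)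
  define xs where "xs i = (rot ^^ i) x0" for i
  have xs_range: "0 \<le> xs i \<and> xs i < s" for i
    by (induction i) (use x0 rot_range in \<open>auto simp: xs_def\<close>)
  have xs_h: "h (xs i) = h x0 + of_nat i * (k - \<kappa> * of_real e)" for i
  proof (induction i)
    case (Suc i)
    have "xs (Suc i) = rot (xs i)" by (simp add: xs_def)
    then show ?case using rot_h[of "xs i"] xs_range[of i] Suc by (simp add: algebra_simps)
  qed (simp add: xs_def)
  have xs_form: "\<exists>w::int. xs i = x0 + of_nat i * e - of_int w * s" for i
  proof (induction i)
    case (Suc i)
    then obtain w :: int where w: "xs i = x0 + of_nat i * e - of_int w * s" by blast
    have "xs (Suc i) = rot (xs i)" by (simp add: xs_def)
    then have "xs (Suc i) = x0 + of_nat (Suc i) * e - of_int w * s \<or>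
               xs (Suc i) = x0 + of_nat (Suc i) * e - of_int (w + 1) * s"
      using w by (auto simp: rot_def algebra_simps)
    then show ?case by blast
  qed (auto simp: xs_def intro!: exI[of _ 0])
  define C where "C = 1 / (1 - cmod \<gamma>) + cmod \<kappa>"
  have h_bound: "cmod (h x) \<le> C" if "0 \<le> x" "x < s" for x
  proof -
    have "cmod (h x) \<le> cmod (\<Phi> x) + cmod (\<kappa> * of_real x)" unfolding h_def by (rule norm_triangle_ineq4)
    also have "cmod (\<kappa> * of_real x) \<le> cmod \<kappa> * 1"
      unfolding norm_mult using that s by (intro mult_left_mono) auto
    finally show ?thesis using norm_\<Phi>_le[of x] by (simp add: C_def)
  qed
  \<comment> \<open>Otherwise the bounded function \<open>h\<close> would drift to infinity along the orbit.\<close>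
  have k: "k = \<kappa> * of_real e"
  proof (rule ccontr)
    assume "\<not> ?thesis"
    then have pos: "0 < cmod (k - \<kappa> * of_real e)" by simp
    obtain i :: nat where i: "2 * C < of_nat i * cmod (k - \<kappa> * of_real e)"
      using reals_Archimedean3[OF pos] by blast
    have "of_nat i * (k - \<kappa> * of_real e) = h (xs i) - h x0" using xs_h[of i] by simp
    then have "of_nat i * cmod (k - \<kappa> * of_real e) = cmod (h (xs i) - h x0)"
      by (metis norm_mult norm_of_nat)
    also have "\<dots> \<le> C + C" using h_bound xs_range[of i] x0 by (intro norm_triangle_le_diff add_mono) auto
    finally show False using i by simp
  qed
  show False
  proof (cases "e / s \<in> \<rat>")
    case True
    \<comment> \<open>The rotation number \<open>e / s\<close> is an integer polynomial in
      \<open>b\<close>. If rational, it is an integer in the range from \<open>0\<close> to below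
      \<open>1\<close>, so \<open>e = 0\<close>, and this is the multinacci equation for
      \<open>\<rho>\<close>.\<close>
    define f :: "int poly" where "f = (\<Sum>k\<in>{..<n}. monom 1 k) - monom 1 n"
    have "ipoly f b = psum b {..<n} - b ^ n" by (simp add: f_def ipoly_diff ipoly_psum ipoly_monom)
    also have "\<dots> = e / s"
    proof -
      have sb: "s * b ^ n = 1" using b by (simp add: s_def \<rho>_def power_one_over)
      have p: "psum b {..<n} = c * b ^ n - c" using c_psum[of n] by simp
      have "(psum b {..<n} - b ^ n) * s = c * (s * b ^ n) - c * s - s * b ^ n"
        unfolding p by (simp add: algebra_simps)
      then have "(psum b {..<n} - b ^ n) * s = e" unfolding sb e by simp
      then show ?thesis using s by (simp add: eq_divide_eq)
    qed
    finally have f: "ipoly f b = e / s" .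
    then have "e / s \<in> \<int>" using int_rat[of f] True by simp
    then obtain j :: int where j: "e / s = of_int j" by (auto elim: Ints_cases)
    have "0 \<le> e / s" "e / s < 1" using e0 es s by auto
    then have "j = 0" using j by linarith
    then have "e = 0" using j s by simp
    then have "psum \<gamma> {1..<Suc n} = 1" "psum \<rho> {1..<Suc n} = 1" using k by (auto simp: k_def e_def)
    then have "\<gamma> = of_real \<rho>" using multinacci_reciprocal_unique[OF n(1) \<rho>(1)] \<gamma> by blast
    then show False using ne b norms_lt_1(3) by (simp add: \<gamma>_def \<rho>_def field_simps)
  next
    case False
    define r where "r = max \<rho> (cmod \<gamma>)"
    have r: "0 \<le> r" "r < 1" using \<rho> \<gamma> by (auto simp: r_def)
    have "cmod (h x0) \<le> C * r ^ N" for N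
    proof -
      define \<delta> where "\<delta> = \<rho> ^ Suc N / 2"
      have "\<rho> ^ Suc N \<le> \<rho>" using \<rho> by (simp add: mult_left_le power_le_one)
      then have \<delta>: "0 < \<delta>" "\<delta> < \<rho>" "\<delta> < \<rho> ^ N" using \<rho> by (auto simp: \<delta>_def)
      \<comment> \<open>In units of \<open>s\<close> the orbit starts at \<open>\<rho>\<close>, so a
        multiple of the rotation number just above \<open>1 - \<rho>\<close> modulo \<open>1\<close>
        brings it to a point \<open>t\<close> just above \<open>0\<close>.\<close>
      obtain i where i: "\<bar>frac (real i * (e / s)) - (1 - \<rho> + \<delta> / 2)\<bar> < \<delta> / 2"
        using Kronecker_approx_1_explicit[OF False, of "1 - \<rho> + \<delta> / 2" "\<delta> / 2"] \<delta> \<rho> by auto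
      define t where "t = frac (real i * (e / s)) + \<rho> - 1"
      have t: "0 < t" "t < \<delta>" using i by (auto simp: t_def abs_if split: if_splits)
      obtain w :: int where w: "xs i = x0 + of_nat i * e - of_int w * s" using xs_form by blast
      have "xs i / s = \<rho> + real i * (e / s) - of_int w" using w x0 s by (simp add: field_simps)
      also have "\<dots> = t + of_int (\<lfloor>real i * (e / s)\<rfloor> + 1 - w)" by (simp add: t_def frac_def)
      finally have 1: "xs i / s = t + of_int (\<lfloor>real i * (e / s)\<rfloor> + 1 - w)" .
      moreover have "0 \<le> xs i / s" "xs i / s < 1" using xs_range[of i] s by auto
      moreover have "t < 1" using t \<delta> \<rho> by linarith
      ultimately have "\<lfloor>real i * (e / s)\<rfloor> + 1 - w = 0" using t by linarith
      with 1 have "xs i / s = t" by simp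
      then have "xs i = t * s" using s by (simp add: field_simps)
      then have "xs i \<le> t" using s t by (simp add: mult_left_le)
      then have xi: "0 \<le> xs i" "xs i \<le> \<rho> ^ N" using xs_range[of i] t \<delta> by auto
      have "\<exists>y. 0 \<le> y \<and> y \<le> l \<and> xs i = \<rho> ^ N * y"
        using xi \<rho> l by (intro exI[of _ "xs i / \<rho> ^ N"]) (auto simp: pos_divide_le_eq intro: order_trans)
      then obtain y where y: "0 \<le> y" "y \<le> l" "xs i = \<rho> ^ N * y" by blast
      \<comment> \<open>A point below \<open>\<rho> ^ N\<close> has an expansion with
        \<open>N\<close> leading zeros, so \<open>h\<close> is of order \<open>r ^ N\<close> there;
        and \<open>h\<close> is constant along the orbit.\<close>
      have "\<Phi> (xs i) = \<gamma> ^ N * \<Phi> y" using \<Phi>_append[of "{}" N y] y by simp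
      then have "cmod (\<Phi> (xs i)) \<le> r ^ N * (1 / (1 - cmod \<gamma>))"
        unfolding norm_mult norm_power using norm_\<Phi>_le[of y] r
        by (simp only: norm_mult norm_power) (intro mult_mono power_mono, auto simp: r_def)
      moreover have "cmod (\<kappa> * of_real (xs i)) \<le> cmod \<kappa> * r ^ N"
      proof -
        have "\<rho> ^ N \<le> r ^ N" using \<rho> by (intro power_mono) (auto simp: r_def)
        then show ?thesis unfolding norm_mult using xi by (intro mult_left_mono) auto
      qed
      ultimately have "cmod (h (xs i)) \<le> r ^ N * (1 / (1 - cmod \<gamma>)) + cmod \<kappa> * r ^ N"
        unfolding h_def by (intro norm_triangle_le_diff add_mono)
      then show ?thesis using xs_h[of i] k by (simp add: C_def algebra_simps)
    qed
    then have "cmod (h x0) \<le> 0" using r by (rule nonpos_if_le_geometric)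
    then have "\<Phi> x0 = \<kappa> * of_real x0" by (simp add: h_def)
    moreover have "\<Phi> x0 = \<gamma> ^ Suc n"
    proof -
      have z: "\<Phi> 0 = 0" using \<Phi>_pseries[of "{}"] by (simp add: pseries_def)
      show ?thesis using \<Phi>_translate[of "{Suc n}" "Suc (Suc n)" 0] \<rho> l z
        by (simp add: psum_def x0_def)
    qed
    ultimately have "of_real \<rho> = \<gamma>" using x0(3) s \<gamma> by (simp add: \<kappa>_def)
    then show False using ne b norms_lt_1(3) by (simp add: \<gamma>_def \<rho>_def field_simps)
  qed
qed

end

theorem small_psum_difference:
  fixes b :: real and \<alpha> :: complex
  assumes "1 < b" "b < 2" "conj_to b \<alpha>" "1 < cmod \<alpha>" "\<alpha> \<noteq> of_real b"
    and "\<And>f :: int poly. ipoly f b \<in> \<rat> \<Longrightarrow> ipoly f b \<in> \<int>" and "0 < \<epsilon>"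
  shows "\<exists>A B. finite A \<and> finite B \<and> psum b A < psum b B \<and> psum b B - psum b A < \<epsilon>"
proof (rule ccontr)
  assume "\<not> ?thesis"
  then have "separated_sums_large_conj b \<alpha> \<epsilon>"
    using assms by unfold_locales (auto simp: not_less, meson linorder_not_le)
  then show False by (rule separated_sums_large_conj.contradiction)
qed

section \<open>Minimal integer polynomials\<close>

lemma ipoly_smult: "ipoly (smult c f) x = of_int c * ipoly f (x::'a::{comm_ring_1,ring_char_0})"
proof -
  have "map_poly of_int (smult c f) = (smult (of_int c) (map_poly of_int f) :: 'a poly)"
    by (rule poly_eqI) (simp add: coeff_map_poly)
  then show ?thesis by simp
qed

lemma ipoly_pCons: "ipoly (pCons c f) x = of_int c + x * ipoly f (x::'a::{comm_ring_1,ring_char_0})"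
  by (simp add: map_poly_pCons)

lemma ipoly_cnj: "ipoly f (cnj z) = cnj (ipoly f z)"
  by (induction f) (auto simp: ipoly_pCons)

lemma ipoly_pcompose: "ipoly (pcompose f g) x = ipoly f (ipoly g (x::'a::{comm_ring_1,ring_char_0}))"
  by (induction f) (auto simp: pcompose_pCons ipoly_add ipoly_mult ipoly_pCons)

text \<open>Gauss's lemma: \<open>p\<close> is the primitive part of an annihilating polynomial of
  least degree. Pseudo-division by \<open>p\<close> leaves no remainder, and comparing contents
  removes the integer factor, so \<open>p\<close> divides over the integers.\<close>

lemma ex_min_int_poly:
  fixes x :: "'a::field_char_0"
  assumes "Q \<noteq> 0" "ipoly Q x = 0"
  obtains p :: "int poly" where "p \<noteq> 0" "ipoly p x = 0" "\<And>f. ipoly f x = 0 \<Longrightarrow> p dvd f"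
proof -
  let ?R = "\<lambda>p. p \<noteq> 0 \<and> ipoly p x = 0"
  define p1 where "p1 = arg_min degree ?R"
  have p1: "?R p1" "\<And>f. ?R f \<Longrightarrow> degree p1 \<le> degree f"
    unfolding p1_def using arg_min_nat_lemma[of ?R Q degree] assms by blast+
  define p where "p = primitive_part p1"
  have p: "p \<noteq> 0" "content p = 1" "degree p = degree p1" using p1 by (auto simp: p_def)
  have "p1 = smult (content p1) p" by (simp add: p_def)
  then have "of_int (content p1) * ipoly p x = 0" using p1(1) ipoly_smult[of "content p1" p x] by simp
  then have px: "ipoly p x = 0" using p1(1) by simp
  have "p dvd f" if f: "ipoly f x = 0" for f
  proof -
    define r where "r = pseudo_mod f p"
    obtain a g where ag: "a \<noteq> 0" "smult a f = p * g + r" using pseudo_mod(1)[OF p(1), of f] by (auto simp: r_def)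
    have "ipoly r x = 0"
      using arg_cong[OF ag(2), of "\<lambda>t. ipoly t x"] f px by (simp add: ipoly_smult ipoly_add ipoly_mult)
    moreover have "r = 0 \<or> degree r < degree p" unfolding r_def by (rule pseudo_mod(2)[OF p(1)])
    ultimately have "r = 0" using p1(2)[of r] p(3) by force
    then have eq: "smult a f = p * g" using ag by simp
    then have "content g = normalize a * content f"
      using content_mult[of p g] p(2) content_smult[of a f] by simp
    then have "[:a:] dvd g" by (simp add: const_poly_dvd_iff_dvd_content)
    then obtain g' where "g = smult a g'" by (auto elim!: dvdE)
    then have "smult a f = smult a (p * g')" using eq by simp
    then have "smult a (f - p * g') = 0" by (simp add: smult_diff_right)
    then have "f = p * g'" using ag(1) by (simp add: smult_eq_0_iff)
    then show ?thesis by simp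
  qed
  then show ?thesis using that p(1) px by blast
qed

lemma degree_pos_if_ipoly_0:
  fixes x :: "'a::field_char_0"
  assumes "p \<noteq> 0" "ipoly p x = 0"
  shows "0 < degree p"
proof (rule ccontr)
  assume "\<not> ?thesis"
  then obtain c where "p = [:c:]" by (metis degree_eq_zeroE gr0I)
  with assms show False by (auto simp: ipoly_pCons)
qed

text \<open>The algebraic units. \<open>Q\<close> may be reducible: its integer factors again have
  leading and constant coefficient of absolute value \<open>1\<close>.\<close>

definition unit_root :: "real \<Rightarrow> bool" where
  "unit_root b \<longleftrightarrow> (\<exists>Q :: int poly. \<bar>lead_coeff Q\<bar> = 1 \<and> \<bar>coeff Q 0\<bar> = 1 \<and> ipoly Q b = 0)"

locale min_int_poly =
  fixes b :: real and p :: "int poly"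
  assumes lead: "\<bar>lead_coeff p\<bar> = 1" and const: "\<bar>coeff p 0\<bar> = 1" and root: "ipoly p b = 0"
    and min: "\<And>f. ipoly f b = 0 \<Longrightarrow> p dvd f"
begin

lemma nz: "p \<noteq> 0"
  using lead by auto

lemma conj_to_iff: "conj_to b z \<longleftrightarrow> ipoly p z = 0"
proof
  assume "conj_to b z"
  then show "ipoly p z = 0" using root by (rule conj_toD)
next
  assume z: "ipoly p z = 0"
  show "conj_to b z"
    unfolding conj_to_def
  proof (intro allI impI)
    fix f :: "int poly"
    assume "ipoly f b = 0"
    then obtain g where "f = p * g" using min by (auto elim: dvdE)
    then show "ipoly f z = 0" using z by (simp add: ipoly_mult)
  qed
qed

text \<open>Irreducibility of \<open>p\<close> in disguise. The minimal polynomial \<open>m\<close>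
  of \<open>z\<close> divides \<open>p\<close>; as \<open>b\<close> cannot be a root of the cofactor
  for degree reasons, it is a root of \<open>m\<close>, and so \<open>p dvd m\<close>.\<close>

lemma min_conj:
  assumes "conj_to b z" "ipoly f z = 0"
  shows "p dvd f"
proof -
  have pz: "ipoly p z = 0" using assms(1) conj_to_iff by simp
  obtain m where m: "m \<noteq> 0" "ipoly m z = 0" "\<And>f. ipoly f z = 0 \<Longrightarrow> m dvd f"
    using ex_min_int_poly[OF nz pz] by blast
  obtain g where g: "p = m * g" using m(3)[OF pz] by (auto elim: dvdE)
  have "g \<noteq> 0" using g nz by auto
  have "ipoly m b * ipoly g b = 0" using root g by (simp add: ipoly_mult)
  then consider "ipoly m b = 0" | "ipoly g b = 0" by auto
  then show ?thesis
  proof cases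
    case 1
    then have "p dvd m" by (rule min)
    then show ?thesis using m(3)[OF assms(2)] by (rule dvd_trans)
  next
    case 2
    then have "p dvd g" by (rule min)
    then have "degree p \<le> degree g" using \<open>g \<noteq> 0\<close> by (rule dvd_imp_degree_le)
    moreover have "degree p = degree m + degree g" using g m(1) \<open>g \<noteq> 0\<close> by (simp add: degree_mult_eq)
    moreover have "0 < degree m" using m by (intro degree_pos_if_ipoly_0)
    ultimately show ?thesis by simp
  qed
qed

text \<open>The leading coefficient is a unit, so \<open>f\<close> reduces modulo \<open>p\<close>
  up to sign. A rational value then gives a relation for \<open>b\<close> of degree below that of
  \<open>p\<close>, which forces the remainder to be constant.\<close>

lemma ipoly_rat_imp_int:
  fixes f :: "int poly"
  assumes "ipoly f b \<in> \<rat>"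
  shows "ipoly f b \<in> \<int>"
proof -
  obtain u v :: int where uv: "v > 0" "ipoly f b = of_int u / of_int v"
    using assms by (metis Rats_cases')
  obtain g r where gr: "pseudo_divmod f p = (g, r)" by force
  define a where "a = lead_coeff p ^ (Suc (degree f) - degree p)"
  have a: "\<bar>a\<bar> = 1" using lead by (simp add: a_def power_abs)
  have eq: "smult a f = p * g + r" and deg: "r = 0 \<or> degree r < degree p"
    using pseudo_divmod[OF nz gr] by (auto simp: a_def)
  have r: "ipoly r b = of_int a * ipoly f b"
    using arg_cong[OF eq, of "\<lambda>t. ipoly t b"] root by (simp add: ipoly_smult ipoly_add ipoly_mult)
  have dp: "0 < degree p" using nz root by (rule degree_pos_if_ipoly_0)
  have "ipoly (smult v r - [:a * u:]) b = 0"
    using uv by (simp add: ipoly_diff ipoly_smult ipoly_pCons r)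
  then have "p dvd smult v r - [:a * u:]" by (rule min)
  moreover have "degree (smult v r - [:a * u:]) < degree p"
    using deg dp by (intro le_less_trans[OF degree_diff_le_max]) auto
  ultimately have "smult v r - [:a * u:] = 0" by (meson dvd_imp_degree_le not_less)
  then have "degree (smult v r) = 0" by simp
  then have "degree r = 0" using uv by simp
  then obtain c where "r = [:c:]" by (auto elim: degree_eq_zeroE)
  then have "of_int a * ipoly f b = of_int c" using r by (simp add: ipoly_pCons)
  moreover have "a = 1 \<or> a = -1" using a by linarith
  ultimately have "ipoly f b = of_int c \<or> ipoly f b = of_int (-c)" by auto
  then show ?thesis by (metis Ints_of_int)
qed

text \<open>The roots are simple: by \<open>min_conj\<close>, a common root of \<open>p\<close> and
  \<open>pderiv p\<close> would make \<open>p\<close> divide its derivative. So the product runs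
  over a set, without multiplicities.\<close>

lemma decompose:
  "map_poly of_int p = smult (of_int (lead_coeff p)) (\<Prod>z | conj_to b z. [:-z, 1:])"
  and finite_conj: "finite {z. conj_to b z}"
proof -
  let ?P = "map_poly of_int p :: complex poly"
  have P0: "?P \<noteq> 0" using nz by (simp add: map_poly_eq_0_iff)
  have roots: "{z. poly ?P z = 0} = {z. conj_to b z}" by (auto simp: conj_to_iff)
  then show "finite {z. conj_to b z}" using poly_roots_finite[OF P0] by simp
  have dp: "0 < degree p" using nz root by (rule degree_pos_if_ipoly_0)
  have "rsquarefree ?P"
    unfolding rsquarefree_roots
  proof (intro allI notI)
    fix z assume "poly ?P z = 0 \<and> poly (pderiv ?P) z = 0"
    moreover have "pderiv ?P = map_poly of_int (pderiv p)"
      by (rule poly_eqI) (simp add: coeff_map_poly coeff_pderiv)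
    ultimately have "conj_to b z" "ipoly (pderiv p) z = 0" by (auto simp: conj_to_iff)
    then have "p dvd pderiv p" by (rule min_conj)
    moreover have "pderiv p \<noteq> 0" using dp by (simp add: pderiv_eq_0_iff)
    ultimately have "degree p \<le> degree (pderiv p)" by (rule dvd_imp_degree_le)
    then show False using dp by (simp add: degree_pderiv)
  qed
  then have "?P = smult (lead_coeff ?P) (\<Prod>z | conj_to b z. [:-z, 1:])"
    using complex_poly_decompose_rsquarefree[of ?P] roots by simp
  moreover have "lead_coeff ?P = of_int (lead_coeff p)"
    by (simp add: coeff_map_poly degree_map_poly)
  ultimately show "?P = smult (of_int (lead_coeff p)) (\<Prod>z | conj_to b z. [:-z, 1:])"
    by simp
qed

lemma prod_conj: "(\<Prod>z | conj_to b z. cmod z) = 1"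
proof -
  have "ipoly p (0::complex) = of_int (lead_coeff p) * (\<Prod>z | conj_to b z. - z)"
    using arg_cong[OF decompose, of "\<lambda>t. poly t 0"] by (simp add: poly_prod)
  moreover have "ipoly p (0::complex) = of_int (coeff p 0)"
    by (simp add: poly_0_coeff_0 coeff_map_poly)
  ultimately have "cmod (of_int (coeff p 0)) = cmod (of_int (lead_coeff p) * (\<Prod>z | conj_to b z. - z))"
    by simp
  then have "of_int \<bar>coeff p 0\<bar> = of_int \<bar>lead_coeff p\<bar> * (\<Prod>z | conj_to b z. cmod z)"
    by (simp add: norm_mult prod_norm[symmetric])
  then show ?thesis using lead const by simp
qed

text \<open>All conjugates together have absolute product \<open>1\<close>, so those outside
  \<open>S\<close> have product above \<open>1\<close>.\<close>

lemma ex_large_conj: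
  assumes "S \<subseteq> {z. conj_to b z}" "(\<Prod>z\<in>S. cmod z) < 1"
  shows "\<exists>z. conj_to b z \<and> z \<notin> S \<and> 1 < cmod z"
proof (rule ccontr)
  assume "\<not> ?thesis"
  then have le: "(\<Prod>z\<in>{z. conj_to b z} - S. cmod z) \<le> 1"
    by (intro prod_le_1) (auto simp: not_less)
  have "1 = (\<Prod>z\<in>{z. conj_to b z} - S. cmod z) * (\<Prod>z\<in>S. cmod z)"
    using prod.subset_diff[OF assms(1) finite_conj, of cmod] prod_conj by simp
  also have "\<dots> \<le> 1 * (\<Prod>z\<in>S. cmod z)"
    using le by (intro mult_right_mono) (auto intro: prod_nonneg)
  finally show False using assms(2) by simp
qed

end

lemma unit_root_min_int_poly:
  assumes "unit_root b"
  obtains p where "min_int_poly b p"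
proof -
  obtain Q :: "int poly" where Q: "\<bar>lead_coeff Q\<bar> = 1" "\<bar>coeff Q 0\<bar> = 1" "ipoly Q b = 0"
    using assms by (auto simp: unit_root_def)
  have "Q \<noteq> 0" using Q by auto
  then obtain p where p: "p \<noteq> 0" "ipoly p b = 0" "\<And>f. ipoly f b = 0 \<Longrightarrow> p dvd f"
    using ex_min_int_poly[OF _ Q(3)] by blast
  obtain g where g: "Q = p * g" using p(3)[OF Q(3)] by (auto elim: dvdE)
  have "\<bar>lead_coeff p\<bar> = 1"
    using Q(1) g by (metis abs_mult lead_coeff_mult abs_zmult_eq_1)
  moreover have "\<bar>coeff p 0\<bar> = 1"
    using Q(2) g by (metis abs_mult coeff_mult_0 abs_zmult_eq_1)
  ultimately show ?thesis using that[of p] p by (simp add: min_int_poly_def)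
qed

section \<open>Large conjugates, inverse conjugates and squares of units\<close>

lemma conj_to_cnj: "conj_to b z \<Longrightarrow> conj_to b (cnj z)"
  by (simp add: conj_to_def ipoly_cnj)

lemma conj_to_self: "conj_to b (of_real b)"
  by (simp add: conj_to_def ipoly_of_real)

lemma conj_to_power: "conj_to b z \<Longrightarrow> conj_to (b ^ n) (z ^ n)"
  unfolding conj_to_def
proof (intro allI impI)
  fix f :: "int poly"
  assume z: "\<forall>f. ipoly f b = 0 \<longrightarrow> ipoly f z = 0" and "ipoly f (b ^ n) = 0"
  then have "ipoly (pcompose f (monom 1 n)) b = 0" by (simp add: ipoly_pcompose ipoly_monom)
  then have "ipoly (pcompose f (monom 1 n)) z = 0" using z by blast
  then show "ipoly f (z ^ n) = 0" by (simp add: ipoly_pcompose ipoly_monom)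
qed

text \<open>In the first case \<open>b\<close> and \<open>\<alpha>\<close> have absolute product
  below \<open>1\<close>. In the second, \<open>b\<close>, \<open>\<alpha>\<close> and
  \<open>cnj \<alpha>\<close> are three distinct conjugates with absolute product
  \<open>1 / b\<close>. Either way \<open>ex_large_conj\<close> applies.\<close>

lemma ex_large_conj_if_small_conj:
  assumes "1 < b" "b < 2" "unit_root b" "conj_to b \<alpha>"
    and "cmod \<alpha> * b < 1 \<or> (\<alpha> \<notin> \<real> \<and> cmod \<alpha> * b = 1)"
  shows "\<exists>z. conj_to b z \<and> z \<noteq> of_real b \<and> 1 < cmod z"
proof -
  obtain p where "min_int_poly b p" using assms(3) by (rule unit_root_min_int_poly)
  then interpret min_int_poly b p .
  have b: "cmod (of_real b) = b" using assms(1) by simp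
  from assms(5) show ?thesis
  proof
    assume a: "cmod \<alpha> * b < 1"
    have "\<alpha> \<noteq> of_real b"
    proof
      assume "\<alpha> = of_real b"
      then have "b * b < 1" using a b by simp
      moreover have "1 * 1 \<le> b * b" using assms(1) by (intro mult_mono) auto
      ultimately show False by simp
    qed
    then have "(\<Prod>z\<in>{of_real b, \<alpha>}. cmod z) < 1" using a b by (simp add: mult.commute)
    then show ?thesis using ex_large_conj[of "{of_real b, \<alpha>}"] assms(4) conj_to_self by auto
  next
    assume a: "\<alpha> \<notin> \<real> \<and> cmod \<alpha> * b = 1"
    then have "\<alpha> \<noteq> of_real b" "cnj \<alpha> \<noteq> of_real b" "\<alpha> \<noteq> cnj \<alpha>"
      by (auto simp: complex_is_Real_iff complex_eq_iff)
    moreover have "b * (cmod \<alpha> * cmod \<alpha>) < 1"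
    proof -
      have "cmod \<alpha> = 1 / b" using a assms(1) by (simp add: field_simps)
      then show ?thesis using assms(1) by simp
    qed
    ultimately have "(\<Prod>z\<in>{of_real b, \<alpha>, cnj \<alpha>}. cmod z) < 1" using b by simp
    then show ?thesis using ex_large_conj[of "{of_real b, \<alpha>, cnj \<alpha>}"] assms(4) conj_to_self conj_to_cnj by auto
  qed
qed

text \<open>If \<open>f\<close> vanishes at \<open>r\<close>, it vanishes at \<open>- 1 / r\<close>,
  so the polynomial \<open>g\<close> obtained from \<open>f (- 1 / x)\<close> by clearing
  denominators vanishes at \<open>r\<close> and hence at \<open>z\<close>.\<close>

lemma conj_to_neg_inverse:
  assumes "r \<noteq> 0" "conj_to r (of_real (- 1 / r))" "conj_to r z" "z \<noteq> 0"
  shows "conj_to r (- 1 / z)"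
  unfolding conj_to_def
proof (intro allI impI)
  fix f :: "int poly" assume f: "ipoly f r = 0"
  define g where "g = (\<Sum>i\<le>degree f. monom (coeff f i * (-1) ^ i) (degree f - i))"
  have g: "ipoly g x = x ^ degree f * ipoly f (- 1 / x)" if "x \<noteq> 0" for x :: "'a::field_char_0"
  proof -
    have "ipoly f (- 1 / x) = (\<Sum>i\<le>degree f. of_int (coeff f i) * (- 1 / x) ^ i)"
      by (simp add: poly_altdef degree_map_poly coeff_map_poly)
    also have "x ^ degree f * \<dots> = (\<Sum>i\<le>degree f. x ^ degree f * (of_int (coeff f i) * (- 1 / x) ^ i))"
      by (simp add: sum_distrib_left)
    also have "\<dots> = (\<Sum>i\<le>degree f. of_int (coeff f i * (-1) ^ i) * x ^ (degree f - i))"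
    proof (intro sum.cong refl)
      fix i assume "i \<in> {..degree f}"
      then have "x ^ (degree f - i) = x ^ degree f / x ^ i" using that by (simp add: power_diff)
      then show "x ^ degree f * (of_int (coeff f i) * (- 1 / x) ^ i) = of_int (coeff f i * (-1) ^ i) * x ^ (degree f - i)"
        unfolding power_divide[of "-1" x i] by simp
    qed
    also have "\<dots> = ipoly g x" by (simp add: g_def ipoly_sum ipoly_monom)
    finally show ?thesis by simp
  qed
  have "ipoly f (of_real (- 1 / r) :: complex) = 0" using assms(2) f by (rule conj_toD)
  then have "ipoly f (- 1 / r) = 0" by (simp only: ipoly_of_real of_real_eq_0_iff)
  then have "ipoly g r = 0" using g[OF assms(1)] by simp
  then have "ipoly g z = 0" using assms(3) by (rule conj_toD[rotated])
  then show "ipoly f (- 1 / z) = 0" using g[OF assms(4)] assms(4) by simp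
qed

text \<open>A further conjugate \<open>\<theta>\<close> would lie on the unit circle by the product
  formula. There \<open>- 1 / cnj \<theta> = - \<theta>\<close> is also a conjugate, which makes
  \<open>- r\<close> a conjugate outside the disc. So only \<open>r\<close> and
  \<open>- 1 / r\<close> remain, and an integrality argument identifies \<open>r\<close>.\<close>

lemma golden_if_no_large_conj:
  assumes r: "1 < r" "r < 2" and unit: "unit_root r" and inv: "conj_to r (of_real (- 1 / r))"
    and small: "\<And>z. conj_to r z \<Longrightarrow> z \<noteq> of_real r \<Longrightarrow> cmod z \<le> 1"
  shows "r\<^sup>2 = r + 1"
proof -
  obtain p where "min_int_poly r p" using unit by (rule unit_root_min_int_poly)
  then interpret min_int_poly r p .
  define w where "w = complex_of_real (- 1 / r)"
  have w: "w \<noteq> of_real r" "cmod w = 1 / r" "conj_to r w"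
  proof -
    have "- 1 / r < 0" using r by simp
    then have "- 1 / r < r" using r by linarith
    then show "w \<noteq> of_real r" by (simp only: w_def of_real_eq_iff)
    show "cmod w = 1 / r" unfolding w_def norm_of_real using r by simp
    show "conj_to r w" using inv by (simp add: w_def)
  qed
  have S: "(\<Prod>z\<in>{of_real r, w}. cmod z) = 1" using w r by simp
  have "{z. conj_to r z} = {of_real r, w}"
  proof (rule ccontr)
    assume "\<not> ?thesis"
    then obtain \<theta> where \<theta>: "conj_to r \<theta>" "\<theta> \<noteq> of_real r" "\<theta> \<noteq> w" using conj_to_self w(3) by blast
    have "cmod \<theta> = 1"
    proof (rule ccontr)
      assume "cmod \<theta> \<noteq> 1"
      then have "cmod \<theta> < 1" using small[OF \<theta>(1,2)] by simp
      moreover have "(\<Prod>z\<in>{\<theta>, of_real r, w}. cmod z) = cmod \<theta> * (\<Prod>z\<in>{of_real r, w}. cmod z)"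
        using \<theta> by simp
      ultimately have "(\<Prod>z\<in>{\<theta>, of_real r, w}. cmod z) < 1" using S by simp
      then show False
        using ex_large_conj[of "{\<theta>, of_real r, w}"] \<theta> w conj_to_self small by force
    qed
    then have "\<theta> * cnj \<theta> = 1" by (simp add: complex_norm_square[symmetric])
    moreover from this have nz: "cnj \<theta> \<noteq> 0" by auto
    ultimately have cnj: "- 1 / cnj \<theta> = - \<theta>" "cnj \<theta> \<noteq> 0"
      by (simp_all add: nonzero_divide_eq_eq)
    have "conj_to r (- 1 / cnj \<theta>)"
      using r inv conj_to_cnj[OF \<theta>(1)] cnj(2) by (intro conj_to_neg_inverse) auto
    then have m: "conj_to r (- \<theta>)" using cnj(1) by simp
    \<comment> \<open>\<open>p (x)\<close> and \<open>p (- x)\<close> share the root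
      \<open>\<theta>\<close>, so by minimality \<open>p\<close> divides \<open>pm\<close> and the
      roots are symmetric about \<open>0\<close>.\<close>
    define pm where "pm = pcompose p [:0, -1:]"
    have pm: "ipoly pm x = ipoly p (- x)" for x :: "'a::{comm_ring_1,ring_char_0}"
      by (simp add: pm_def ipoly_pcompose ipoly_pCons)
    have "ipoly pm \<theta> = 0" using m by (simp only: pm[of \<theta>] conj_to_iff)
    then have "p dvd pm" by (rule min_conj[OF \<theta>(1)])
    then have "ipoly pm r = 0" using root by (auto simp: ipoly_mult elim!: dvdE)
    then have "ipoly p (- r) = 0" by (simp only: pm[of r])
    then have "conj_to r (of_real (- r))" by (simp only: conj_to_iff ipoly_of_real of_real_0)
    then have "cmod (of_real (- r)) \<le> 1" using r by (intro small) (auto simp: complex_eq_iff)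
    then show False using r by simp
  qed
  \<comment> \<open>The integer \<open>p (1)\<close> is, up to sign, \<open>r - 1 / r\<close>, which
    lies strictly between \<open>0\<close> and \<open>2\<close>.\<close>
  then have "ipoly p (1::complex) = of_int (lead_coeff p) * ((1 - of_real r) * (1 - w))"
    using arg_cong[OF decompose, of "\<lambda>t. poly t 1"] w(1) by (simp add: algebra_simps)
  also have "\<dots> = of_real (of_int (lead_coeff p) * ((1 - r) * (1 + 1 / r)))"
    by (simp add: w_def)
  finally have "complex_of_real (ipoly p 1) = of_real (of_int (lead_coeff p) * ((1 - r) * (1 + 1 / r)))"
    using ipoly_of_real[of p 1, where ?'a = complex] by simp
  then have 1: "ipoly p (1::real) = of_int (lead_coeff p) * ((1 - r) * (1 + 1 / r))"
    by (simp only: of_real_eq_iff)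
  have "ipoly p (1::real) \<in> \<int>" by (induction p) (auto simp: ipoly_pCons)
  then obtain j :: int where "ipoly p (1::real) = of_int j" by (auto elim: Ints_cases)
  then have "of_int (lead_coeff p) * ((1 - r) * (1 + 1 / r)) = of_int j" using 1 by simp
  moreover have "(1 - r) * (1 + 1 / r) = - (r - 1 / r)" using r by (simp add: field_simps)
  moreover have "lead_coeff p = 1 \<or> lead_coeff p = -1" using lead by linarith
  ultimately have "r - 1 / r = of_int j \<or> r - 1 / r = of_int (- j)" by auto
  then obtain i :: int where i: "r - 1 / r = of_int i" by blast
  have "0 < 1 / r" "1 / r < 1" using r by auto
  then have "0 < r - 1 / r" "r - 1 / r < 2" using r by linarith+
  then have "i = 1" using i by simp
  then show ?thesis using i r by (simp add: field_simps power2_eq_square)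
qed

text \<open>Dividing out the largest power of the variable leaves constant and leading coefficients
  that are nonzero, hence of absolute value \<open>1\<close>.\<close>

lemma unit_root_if_littlewood:
  fixes P :: "int poly"
  assumes "P \<noteq> 0" "\<forall>i. coeff P i \<in> {-1, 0, 1}" "ipoly P q = 0" "q \<noteq> 0"
  shows "unit_root q"
proof -
  define k where "k = (LEAST i. coeff P i \<noteq> 0)"
  have "coeff P (degree P) \<noteq> 0" using assms(1) by simp
  then have k: "coeff P k \<noteq> 0" unfolding k_def by (rule LeastI)
  have lt: "coeff P i = 0" if "i < k" for i using not_less_Least that unfolding k_def by blast
  define Q where "Q = poly_shift k P"
  have PQ: "P = monom 1 k * Q"
    by (rule poly_eqI) (use lt in \<open>auto simp: coeff_monom_mult Q_def coeff_poly_shift not_le\<close>)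
  then have "Q \<noteq> 0" using assms(1) by auto
  have "coeff Q i \<in> {-1, 0, 1}" for i using assms(2) by (simp only: Q_def coeff_poly_shift)
  then have abs: "\<bar>coeff Q i\<bar> = 1" if "coeff Q i \<noteq> 0" for i
    using that by (metis abs_1 abs_neg_one empty_iff insert_iff)
  have "\<bar>lead_coeff Q\<bar> = 1" using \<open>Q \<noteq> 0\<close> by (intro abs) simp
  moreover have "\<bar>coeff Q 0\<bar> = 1" using k by (intro abs) (simp add: Q_def coeff_poly_shift)
  moreover have "ipoly Q q = 0"
    using assms(3,4) arg_cong[OF PQ, of "\<lambda>t. ipoly t q"] by (simp add: ipoly_mult ipoly_monom)
  ultimately show ?thesis by (auto simp: unit_root_def)
qed

lemma unit_root_square:
  assumes "unit_root q"
  shows "unit_root (q\<^sup>2)"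
proof -
  obtain Q :: "int poly" where Q: "\<bar>lead_coeff Q\<bar> = 1" "\<bar>coeff Q 0\<bar> = 1" "ipoly Q q = 0"
    using assms by (auto simp: unit_root_def)
  define n where "n = degree Q"
  \<comment> \<open>\<open>Q(x) Q(-x)\<close> is a polynomial in \<open>x\<^sup>2\<close>.\<close>
  define Qm where "Qm = pcompose Q [:0, -1:]"
  have cQm: "coeff Qm i = (-1) ^ i * coeff Q i" for i
    unfolding Qm_def using coeff_pcompose_linear[of Q "-1" i] by simp
  define G where "G = (\<Sum>i\<le>n. monom (coeff (Q * Qm) (2 * i)) i)"
  have cG: "coeff G i = (if i \<le> n then coeff (Q * Qm) (2 * i) else 0)" for i
    by (simp add: G_def coeff_sum)
  \<comment> \<open>Reversing the order of summation negates every term when \<open>k\<close> is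
    odd.\<close>
  have odd: "coeff (Q * Qm) k = 0" if "odd k" for k
  proof -
    let ?S = "\<Sum>i\<le>k. coeff Q i * coeff Qm (k - i)"
    have "?S = (\<Sum>i\<le>k. coeff Q (k - i) * coeff Qm (k - (k - i)))"
      by (rule sum.reindex_bij_witness[of _ "\<lambda>i. k - i" "\<lambda>i. k - i"]) auto
    also have "\<dots> = (\<Sum>i\<le>k. - (coeff Q i * coeff Qm (k - i)))"
    proof (intro sum.cong refl)
      fix i assume "i \<in> {..k}"
      then have "(- 1 :: int) ^ i = - ((-1) ^ (k - i))"
        using that by (auto simp: minus_one_power_iff)
      then show "coeff Q (k - i) * coeff Qm (k - (k - i)) = - (coeff Q i * coeff Qm (k - i))"
        using \<open>i \<in> {..k}\<close> by (simp add: cQm)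
    qed
    also have "\<dots> = - ?S" by (simp add: sum_negf)
    finally show ?thesis by (simp add: coeff_mult)
  qed
  have dQm: "degree Qm = n" by (simp add: Qm_def n_def degree_pcompose)
  have "\<bar>coeff (Q * Qm) (n + n)\<bar> = 1"
    using coeff_mult_degree_sum[of Q Qm] Q(1) cQm[of n] dQm by (simp add: n_def abs_mult power_abs)
  then have G1: "\<bar>coeff G n\<bar> = 1" by (simp add: cG mult_2)
  have "degree G = n"
    using G1 by (intro antisym degree_le le_degree) (auto simp: cG)
  then have 1: "\<bar>lead_coeff G\<bar> = 1" using G1 by simp
  have 2: "\<bar>coeff G 0\<bar> = 1" using Q(2) by (simp add: cG coeff_mult_0 cQm abs_mult)
  have "ipoly (Q * Qm) q = (\<Sum>k\<le>2 * n. of_int (coeff (Q * Qm) k) * q ^ k)"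
  proof -
    have deg: "degree (Q * Qm) \<le> 2 * n" using degree_mult_le[of Q Qm] dQm by (simp add: n_def)
    have "ipoly (Q * Qm) q = (\<Sum>k\<le>degree (Q * Qm). of_int (coeff (Q * Qm) k) * q ^ k)"
      by (simp add: poly_altdef degree_map_poly coeff_map_poly)
    also have "\<dots> = (\<Sum>k\<le>2 * n. of_int (coeff (Q * Qm) k) * q ^ k)"
    proof (rule sum.mono_neutral_left)
      show "{..degree (Q * Qm)} \<subseteq> {..2 * n}" using deg by auto
      show "\<forall>k\<in>{..2 * n} - {..degree (Q * Qm)}. of_int (coeff (Q * Qm) k) * q ^ k = 0"
        by (auto simp: coeff_eq_0)
    qed simp
    finally show ?thesis .
  qed
  also have "\<dots> = (\<Sum>k\<in>(*) 2 ` {..n}. of_int (coeff (Q * Qm) k) * q ^ k)"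
  proof (intro sum.mono_neutral_right ballI)
    fix k assume k: "k \<in> {..2 * n} - (*) 2 ` {..n}"
    have "odd k"
    proof
      assume "even k"
      then obtain j where "k = 2 * j" by blast
      with k show False by auto
    qed
    then show "of_int (coeff (Q * Qm) k) * q ^ k = 0" using odd by simp
  qed auto
  also have "\<dots> = (\<Sum>i\<le>n. of_int (coeff (Q * Qm) (2 * i)) * q ^ (2 * i))"
    by (simp add: sum.reindex inj_on_def)
  also have "\<dots> = ipoly G (q\<^sup>2)" by (simp add: G_def ipoly_sum ipoly_monom power_mult)
  finally have "ipoly G (q\<^sup>2) = 0" using Q(3) by (simp add: ipoly_mult)
  then show ?thesis using 1 2 by (auto simp: unit_root_def)
qed

lemma map_poly_of_rat_mult:
  "map_poly of_rat (p * r) = (map_poly of_rat p * map_poly of_rat r :: 'a::field_char_0 poly)"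
  by (rule poly_eqI) (simp add: coeff_map_poly coeff_mult of_rat_sum of_rat_mult)

lemma conj_to_if_conjugates:
  assumes "unit_root q" "\<alpha> \<in> conjugates q"
  shows "conj_to q \<alpha>"
proof -
  have of_int: "map_poly of_rat (map_poly of_int f) = (map_poly of_int f :: 'a::field_char_0 poly)" for f
    by (rule poly_eqI) (simp add: coeff_map_poly)
  obtain Q :: "int poly" where Q: "\<bar>lead_coeff Q\<bar> = 1" "ipoly Q q = 0"
    using assms by (auto simp: unit_root_def)
  then have Q0: "map_poly rat_of_int Q \<noteq> 0" by (auto simp: map_poly_eq_0_iff)
  define m where "m = rat_minpoly q"
  have "\<exists>!m. is_rat_minpoly m q"
    by (rule rat_minpoly_unique[OF Q0]) (simp add: of_int Q(2))
  then have "is_rat_minpoly m q" unfolding m_def rat_minpoly_def by (rule theI')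
  then have m: "lead_coeff m = 1" "poly (map_poly of_rat m) q = 0"
    "\<And>r. r \<noteq> 0 \<Longrightarrow> poly (map_poly of_rat r) q = 0 \<Longrightarrow> degree m \<le> degree r"
    by (auto simp: is_rat_minpoly_def)
  have \<alpha>: "poly (map_poly of_rat m) \<alpha> = 0" using assms(2) by (simp add: conjugates_def m_def)
  show ?thesis
    unfolding conj_to_def
  proof (intro allI impI)
    fix f :: "int poly" assume f: "ipoly f q = 0"
    define F where "F = map_poly rat_of_int f"
    have "F mod m = F - m * (F div m)" by (simp add: minus_mult_div_eq_mod)
    then have "poly (map_poly of_rat (F mod m)) q = 0"
      using f m(2) by (simp add: map_poly_of_rat_diff map_poly_of_rat_mult F_def of_int)
    moreover have "m \<noteq> 0" using m(1) by auto
    ultimately have "F mod m = 0" using m(3)[of "F mod m"] degree_mod_less[of m F] by force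
    then have "F = m * (F div m)" by (simp add: minus_mult_div_eq_mod[symmetric])
    then have "poly (map_poly of_rat F) \<alpha> = 0" using \<alpha>
      by (metis map_poly_of_rat_mult mult_zero_left poly_mult)
    then show "ipoly f \<alpha> = 0" by (simp add: F_def of_int)
  qed
qed

section \<open>Gaps\<close>

lemma psum_in_Yset:
  assumes "finite A"
  shows "psum q A \<in> Yset q"
proof -
  obtain n where n: "A \<subseteq> {..<n}"
    using assms finite_nat_bounded by blast
  \<comment> \<open>The upper limit \<open>Suc n\<close> ensures the index at least \<open>1\<close>
    that \<open>Yset\<close> demands.\<close>
  have "psum q A = (\<Sum>k\<le>Suc n. of_bool (k \<in> A) * q ^ k)"
    unfolding psum_def by (rule sum.mono_neutral_cong_left) (use n in auto)
  then have "psum q A \<in> Yn (Suc n) q" by (auto simp: Yn_def intro!: exI[of _ "\<lambda>k. of_bool (k \<in> A)"])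
  then show ?thesis by (fastforce simp: Yset_def)
qed

lemma psum_diff_in_Lam:
  assumes "finite A" "finite B"
  shows "psum q A - psum q B \<in> Lam q"
proof -
  obtain n where n: "A \<union> B \<subseteq> {..<n}"
    using assms finite_nat_bounded[of "A \<union> B"] by blast
  have "psum q C = (\<Sum>k\<le>Suc n. of_bool (k \<in> C) * q ^ k)" if "C \<subseteq> {..<n}" for C
    unfolding psum_def by (rule sum.mono_neutral_cong_left) (use that in auto)
  then have "psum q A - psum q B = (\<Sum>k\<le>Suc n. (of_bool (k \<in> A) - of_bool (k \<in> B)) * q ^ k)"
    using n by (simp add: sum_subtractf left_diff_distrib)
  then show ?thesis unfolding Lam_def
    by (intro CollectI exI[of _ "\<lambda>k. of_bool (k \<in> A) - of_bool (k \<in> B)"] exI[of _ "Suc n"]) auto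
qed

lemma yseq_Suc_le:
  assumes "1 < q" "y \<in> Yset q" "yseq q n < y"
  shows "yseq q (Suc n) \<le> y"
proof -
  obtain m where m: "y = yseq q m" using assms range_yseq[OF assms(1)] by blast
  then have "n < m" using assms yseq_strict_mono[OF assms(1)] by (simp add: strict_mono_less)
  then show ?thesis using m yseq_strict_mono[OF assms(1)] by (simp add: strict_mono_less_eq)
qed

lemma lgap_nonneg:
  assumes "1 < q"
  shows "0 \<le> lgap q"
  unfolding lgap_def
  by (intro Liminf_bounded always_eventually allI)
     (use yseq_strict_mono[OF assms] in \<open>auto simp: strict_mono_less_eq\<close>)

text \<open>Adding one high power \<open>q ^ K\<close> to both sums keeps their difference and moves
  them beyond any given element, so small gaps recur arbitrarily far out.\<close>

lemma lgap_eq_0: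
  assumes q: "1 < q"
    and small: "\<And>\<epsilon>. 0 < \<epsilon> \<Longrightarrow> \<exists>A B. finite A \<and> finite B \<and> psum q A < psum q B \<and> psum q B - psum q A < \<epsilon>"
  shows "lgap q = 0"
proof (rule ccontr)
  assume "lgap q \<noteq> 0"
  then have "0 < lgap q" using lgap_nonneg[OF q] by simp
  then obtain \<epsilon> where \<epsilon>: "0 < ereal \<epsilon>" "ereal \<epsilon> < lgap q" using ereal_dense2 by blast
  then have "\<forall>\<^sub>F n in sequentially. ereal \<epsilon> < ereal (yseq q (Suc n) - yseq q n)"
    unfolding lgap_def by (intro less_LiminfD)
  then obtain N where N: "\<And>n. N \<le> n \<Longrightarrow> \<epsilon> < yseq q (Suc n) - yseq q n"
    by (auto simp: eventually_sequentially)
  obtain A B where AB: "finite A" "finite B" "psum q A < psum q B" "psum q B - psum q A < \<epsilon>"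
    using small \<epsilon>(1) by (metis ereal_less(2))
  obtain m where m: "A \<union> B \<subseteq> {..<m}" using AB finite_nat_bounded[of "A \<union> B"] by blast
  obtain K' where K': "yseq q N < q ^ K'" using q real_arch_pow by blast
  define K where "K = m + K'"
  have "q ^ K' \<le> q ^ K" using q by (simp add: K_def)
  have ins: "psum q (insert K C) = q ^ K + psum q C" if "C \<subseteq> A \<union> B" for C
    using that m AB by (intro psum_insert) (auto simp: K_def intro: finite_subset)
  have "psum q (insert K A) \<in> Yset q" "psum q (insert K B) \<in> Yset q" using AB by (auto intro!: psum_in_Yset)
  then obtain n where n: "yseq q n = q ^ K + psum q A" and Y: "q ^ K + psum q B \<in> Yset q"
    using ins range_yseq[OF q] by (metis (no_types, lifting) Un_upper1 Un_upper2 imageE)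
  have "yseq q (Suc n) \<le> q ^ K + psum q B" using AB n Y by (intro yseq_Suc_le[OF q]) auto
  then have "yseq q (Suc n) - yseq q n < \<epsilon>" using n AB by simp
  moreover have "yseq q N < yseq q n" using n K' \<open>q ^ K' \<le> q ^ K\<close> psum_nonneg[of q A] q by linarith
  then have "N \<le> n" using yseq_strict_mono[OF q] by (simp add: strict_mono_less)
  ultimately show False using N[of n] by simp
qed

lemma Lgap_eq_0:
  assumes q: "1 < q"
    and dense: "\<And>\<epsilon>. 0 < \<epsilon> \<Longrightarrow> \<exists>x0. \<forall>x\<ge>x0. \<exists>A. finite A \<and> psum q A \<le> x \<and> x < psum q A + \<epsilon>"
  shows "Lgap q = 0"
proof (rule antisym)
  have "Lgap q \<le> 0 + ereal \<epsilon>" if \<epsilon>: "0 < \<epsilon>" for \<epsilon>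
  proof -
    obtain x0 where x0: "\<And>x. x0 \<le> x \<Longrightarrow> \<exists>A. finite A \<and> psum q A \<le> x \<and> x < psum q A + \<epsilon>"
      using dense[OF \<epsilon>] by blast
    obtain y where "y \<in> Yset q" "x0 < y" using Y_unbounded[OF q] by blast
    then obtain N where N: "x0 < yseq q N" using range_yseq[OF q] by (metis imageE)
    have "yseq q (Suc n) - yseq q n \<le> \<epsilon>" if "N \<le> n" for n
    proof -
      have "yseq q N \<le> yseq q n" using that yseq_strict_mono[OF q] by (simp add: strict_mono_less_eq)
      \<comment> \<open>Applied at \<open>yseq q n + \<epsilon>\<close>, the density gives a sum
        strictly above \<open>yseq q n\<close> by at most \<open>\<epsilon>\<close>.\<close>
      then obtain A where A: "finite A" "psum q A \<le> yseq q n + \<epsilon>" "yseq q n + \<epsilon> < psum q A + \<epsilon>"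
        using x0[of "yseq q n + \<epsilon>"] N \<epsilon> by auto
      then have "yseq q (Suc n) \<le> psum q A" by (intro yseq_Suc_le[OF q] psum_in_Yset) auto
      then show ?thesis using A by simp
    qed
    then show ?thesis unfolding Lgap_def
      by (intro Limsup_bounded) (auto simp: eventually_sequentially)
  qed
  then show "Lgap q \<le> 0" by (rule ereal_le_epsilon2)
  have "lgap q \<le> Lgap q" unfolding lgap_def Lgap_def by (intro Liminf_le_Limsup) simp
  then show "0 \<le> Lgap q" using lgap_nonneg[OF q] by simp
qed

section \<open>From small differences to fine approximation\<close>

lemma nat_interval_step:
  fixes f :: "nat \<Rightarrow> real"
  assumes "f 0 \<le> y" "y < f K"
  shows "\<exists>i<K. f i \<le> y \<and> y < f (Suc i)"
  using assms(2)
proof (induction K)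
  case 0
  then show ?case using assms(1) by simp
next
  case (Suc K)
  then show ?case by (cases "y < f K") (auto simp: less_Suc_eq)
qed

text \<open>The exponents are confined to \<open>S\<close> so that the remaining ones stay free for
  a coarse approximation.\<close>

definition small_differences :: "real \<Rightarrow> nat set \<Rightarrow> bool" where
  "small_differences q S \<longleftrightarrow> (\<forall>\<epsilon>>0. \<exists>A B. finite A \<and> finite B \<and> A \<subseteq> S \<and> B \<subseteq> S \<and>
     psum q A < psum q B \<and> psum q B - psum q A < \<epsilon>)"

text \<open>A tiny difference is scaled by \<open>q ^ m\<close> until it enters the window from
  \<open>\<epsilon> / q ^ m\<close> to \<open>\<epsilon>\<close>; each scaling shifts the exponents
  by \<open>m\<close> inside \<open>S\<close>.\<close>

lemma ex_far_difference:
  assumes q: "1 < q" and m: "0 < m" "\<And>k. k \<in> S \<Longrightarrow> m + k \<in> S"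
    and small: "small_differences q S" and \<epsilon>: "0 < \<epsilon>"
  shows "\<exists>A B. finite A \<and> finite B \<and> A \<subseteq> S \<inter> {N..} \<and> B \<subseteq> S \<inter> {N..} \<and>
    \<epsilon> / q ^ m \<le> psum q B - psum q A \<and> psum q B - psum q A < \<epsilon>"
proof -
  \<comment> \<open>So small that more than \<open>N\<close> scalings are necessary, which pushes
    all exponents beyond \<open>N\<close>.\<close>
  have "0 < \<epsilon> / q ^ m / (q ^ m) ^ N" using \<epsilon> q by simp
  then obtain A B where AB: "finite A" "finite B" "A \<subseteq> S" "B \<subseteq> S" "psum q A < psum q B"
    "psum q B - psum q A < \<epsilon> / q ^ m / (q ^ m) ^ N"
    using small unfolding small_differences_def by meson
  define \<delta> where "\<delta> = psum q B - psum q A"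
  have \<delta>: "0 < \<delta>" "\<delta> * (q ^ m) ^ N < \<epsilon> / q ^ m" using AB q by (auto simp: \<delta>_def pos_less_divide_eq mult_ac)
  have qm: "1 < q ^ m" using q m by simp
  obtain J where J: "\<epsilon> / q ^ m / \<delta> < (q ^ m) ^ J" using qm real_arch_pow by blast
  define j where "j = (LEAST j. \<epsilon> / q ^ m \<le> \<delta> * (q ^ m) ^ j)"
  have "\<epsilon> / q ^ m \<le> \<delta> * (q ^ m) ^ J" using J \<delta> pos_divide_less_eq[OF \<delta>(1), of "\<epsilon> / q ^ m"] by (simp add: mult.commute)
  then have j: "\<epsilon> / q ^ m \<le> \<delta> * (q ^ m) ^ j" unfolding j_def by (rule LeastI)
  have jN: "N < j"
  proof (rule ccontr)
    assume "\<not> N < j"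
    then have "\<delta> * (q ^ m) ^ j \<le> \<delta> * (q ^ m) ^ N" using \<delta> qm by (intro mult_left_mono power_increasing) auto
    then show False using j \<delta>(2) by linarith
  qed
  then obtain i where i: "j = Suc i" by (cases j) auto
  have "\<not> \<epsilon> / q ^ m \<le> \<delta> * (q ^ m) ^ i" 
    using not_less_Least[of i "\<lambda>j. \<epsilon> / q ^ m \<le> \<delta> * (q ^ m) ^ j"] i unfolding j_def by simp
  then have "\<delta> * (q ^ m) ^ j < \<epsilon>" using i q by (simp add: field_simps)
  moreover have shift: "m * n + k \<in> S" if "k \<in> S" for n k
    using that m(2) by (induction n) (auto simp: add.assoc)
  have "(+) (m * j) ` C \<subseteq> S \<inter> {N..}" if "C \<subseteq> S" for C
  proof -
    have "1 * j \<le> m * j" using m(1) by (intro mult_le_mono1) simp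
    then have "N \<le> m * j" using jN by linarith
    then show ?thesis using that shift by (auto intro: trans_le_add1)
  qed
  moreover have "psum q ((+) (m * j) ` B) - psum q ((+) (m * j) ` A) = \<delta> * (q ^ m) ^ j"
    unfolding psum_shift \<delta>_def power_mult by (simp add: algebra_simps)
  ultimately show ?thesis using AB j
    by (intro exI[of _ "(+) (m * j) ` A"] exI[of _ "(+) (m * j) ` B"]) auto
qed

lemma ex_chain:
  assumes q: "1 < q" and m: "0 < m" "\<And>k. k \<in> S \<Longrightarrow> m + k \<in> S"
    and small: "small_differences q S" and \<epsilon>: "0 < \<epsilon>"
  shows "\<exists>U :: nat \<Rightarrow> nat set. (\<forall>i\<le>K. finite (U i) \<and> U i \<subseteq> S) \<and>
    (\<forall>i<K. \<epsilon> / q ^ m \<le> psum q (U (Suc i)) - psum q (U i) \<and> psum q (U (Suc i)) - psum q (U i) < \<epsilon>)"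
proof (induction K)
  case 0
  show ?case by (intro exI[of _ "\<lambda>_. {}"]) auto
next
  case (Suc K)
  then obtain U where U: "\<And>i. i \<le> K \<Longrightarrow> finite (U i) \<and> U i \<subseteq> S"
    "\<And>i. i < K \<Longrightarrow> \<epsilon> / q ^ m \<le> psum q (U (Suc i)) - psum q (U i) \<and> psum q (U (Suc i)) - psum q (U i) < \<epsilon>"
    by metis
  have "finite (\<Union>i\<le>K. U i)" using U by auto
  then obtain N where N: "(\<Union>i\<le>K. U i) \<subseteq> {..<N}" using finite_nat_bounded by blast
  obtain A B where AB: "finite A" "finite B" "A \<subseteq> S \<inter> {N..}" "B \<subseteq> S \<inter> {N..}"
    "\<epsilon> / q ^ m \<le> psum q B - psum q A" "psum q B - psum q A < \<epsilon>"
    using ex_far_difference[OF q m small \<epsilon>, of N] by blast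
  \<comment> \<open>\<open>A\<close> is added to all earlier sets, which keeps their differences,
    and \<open>B\<close> replaces it once for the new last step. Their exponents lie beyond those
    already used.\<close>
  define U' where "U' i = (if i \<le> K then U i \<union> A else U K \<union> B)" for i
  have disj: "U i \<inter> A = {}" "U i \<inter> B = {}" if "i \<le> K" for i
    using that AB N by (fastforce simp: disjoint_iff)+
  have "psum q (U i \<union> A) = psum q (U i) + psum q A" "psum q (U i \<union> B) = psum q (U i) + psum q B"
    if "i \<le> K" for i using psum_Un[OF _ AB(1) disj(1)[OF that]] psum_Un[OF _ AB(2) disj(2)[OF that]] U(1)[OF that] by auto
  then have "\<forall>i<Suc K. \<epsilon> / q ^ m \<le> psum q (U' (Suc i)) - psum q (U' i) \<and> psum q (U' (Suc i)) - psum q (U' i) < \<epsilon>"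
    using U AB by (auto simp: U'_def less_Suc_eq)
  moreover have "\<forall>i\<le>Suc K. finite (U' i) \<and> U' i \<subseteq> S" using U AB by (auto simp: U'_def)
  ultimately show ?case by blast
qed

text \<open>The upper bound on the chain steps gives precision \<open>\<epsilon>\<close>, the lower
  bound lets finitely many of them pass \<open>G\<close>. The base set \<open>A0\<close> is the
  start of the chain.\<close>

lemma chain_approx:
  assumes q: "1 < q" and m: "0 < m" "\<And>k. k \<in> S \<Longrightarrow> m + k \<in> S"
    and small: "small_differences q S" and \<epsilon>: "0 < \<epsilon>"
  shows "\<exists>\<U>. finite \<U> \<and> (\<forall>A\<in>\<U>. finite A \<and> A \<subseteq> S) \<and> (\<exists>A0\<in>\<U>. \<forall>y. 0 \<le> y \<and> y < G \<longrightarrow>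
    (\<exists>A\<in>\<U>. psum q A - psum q A0 \<le> y \<and> y < psum q A - psum q A0 + \<epsilon>))"
proof -
  have pos: "0 < \<epsilon> / q ^ m" using \<epsilon> q by simp
  obtain K :: nat where K: "G < of_nat K * (\<epsilon> / q ^ m)" using reals_Archimedean3[OF pos] by blast
  obtain U where U: "\<And>i. i \<le> K \<Longrightarrow> finite (U i) \<and> U i \<subseteq> S"
    "\<And>i. i < K \<Longrightarrow> \<epsilon> / q ^ m \<le> psum q (U (Suc i)) - psum q (U i) \<and> psum q (U (Suc i)) - psum q (U i) < \<epsilon>"
    using ex_chain[OF q m small \<epsilon>, of K] by metis
  define f where "f i = psum q (U i) - psum q (U 0)" for i
  have "of_nat i * (\<epsilon> / q ^ m) \<le> f i" if "i \<le> K" for i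
    using that
  proof (induction i)
    case (Suc i)
    then show ?case using U(2)[of i] by (simp add: f_def algebra_simps add_divide_distrib)
  qed (simp add: f_def)
  then have fK: "G < f K" using K by force
  have "\<exists>A\<in>U ` {..K}. psum q A - psum q (U 0) \<le> y \<and> y < psum q A - psum q (U 0) + \<epsilon>" if y: "0 \<le> y" "y < G" for y
  proof -
    have "f 0 \<le> y" "y < f K" using y fK by (auto simp: f_def)
    then obtain i where "i < K" "f i \<le> y" "y < f (Suc i)" using nat_interval_step by blast
    then show ?thesis using U(2)[of i] by (intro bexI[of _ "U i"]) (auto simp: f_def)
  qed
  then show ?thesis using U(1) by (intro exI[of _ "U ` {..K}"]) blast
qed

lemma Lam_dense:
  assumes q: "1 < q" and small: "small_differences q UNIV"
  shows "closure (Lam q) = UNIV"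
proof -
  have uminus: "- x \<in> Lam q" if x: "x \<in> Lam q" for x
  proof -
    obtain a n where "x = (\<Sum>k\<le>n. a k * q ^ k)" "1 \<le> n" "\<forall>k\<le>n. a k \<in> {-1, 0, 1}"
      using x unfolding Lam_def by blast
    then show ?thesis unfolding Lam_def
      by (intro CollectI exI[of _ "\<lambda>k. - a k"] exI[of _ n]) (auto simp: sum_negf)
  qed
  have pos: "\<exists>x\<in>Lam q. \<bar>x - t\<bar> < \<epsilon>" if t: "0 \<le> t" "0 < \<epsilon>" for t \<epsilon> :: real
  proof -
    obtain \<U> A0 where \<U>: "\<forall>A\<in>\<U>. finite A" "A0 \<in> \<U>"
      "\<forall>y. 0 \<le> y \<and> y < t + 1 \<longrightarrow> (\<exists>A\<in>\<U>. psum q A - psum q A0 \<le> y \<and> y < psum q A - psum q A0 + \<epsilon>)"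
      using chain_approx[OF q, of 1 UNIV \<epsilon> "t + 1"] small t(2) by auto
    obtain A where "A \<in> \<U>" "psum q A - psum q A0 \<le> t" "t < psum q A - psum q A0 + \<epsilon>"
      using \<U>(3)[rule_format, of t] t(1) by auto
    then show ?thesis using \<U>(1,2) by (intro bexI[of _ "psum q A - psum q A0"] psum_diff_in_Lam) auto
  qed
  have "t \<in> closure (Lam q)" for t
    unfolding closure_approachable dist_real_def
  proof (intro allI impI)
    fix \<epsilon> :: real assume \<epsilon>: "0 < \<epsilon>"
    show "\<exists>x\<in>Lam q. \<bar>x - t\<bar> < \<epsilon>"
    proof (cases "0 \<le> t")
      case False
      then obtain x where "x \<in> Lam q" "\<bar>x - (- t)\<bar> < \<epsilon>" using pos[of "- t" \<epsilon>] \<epsilon> by auto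
      then show ?thesis using uminus[of x] by (intro bexI[of _ "- x"]) auto
    qed (use pos \<epsilon> in auto)
  qed
  then show ?thesis by blast
qed

text \<open>Exponents in \<open>T\<close> approximate greedily with error below \<open>G\<close>;
  the finite family from \<open>chain_approx\<close> over \<open>S\<close> then corrects that error
  to below \<open>\<epsilon>\<close>. Since \<open>S\<close> and \<open>T\<close> are disjoint, the
  union is again a sum of distinct powers.\<close>

lemma Lgap_eq_0_if_split:
  assumes q: "1 < q" and m: "0 < m" "\<And>k. k \<in> S \<Longrightarrow> m + k \<in> S"
    and small: "small_differences q S"
    and T: "S \<inter> T = {}" "infinite T" "\<And>k. k \<in> T \<Longrightarrow> q ^ k \<le> G + psum q (T \<inter> {..<k})"
  shows "Lgap q = 0"
proof (rule Lgap_eq_0[OF q])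
  fix \<epsilon> :: real assume \<epsilon>: "0 < \<epsilon>"
  obtain \<U> A0 where \<U>: "\<forall>A\<in>\<U>. finite A \<and> A \<subseteq> S" "A0 \<in> \<U>"
    "\<forall>y. 0 \<le> y \<and> y < G \<longrightarrow> (\<exists>A\<in>\<U>. psum q A - psum q A0 \<le> y \<and> y < psum q A - psum q A0 + \<epsilon>)"
    using chain_approx[OF q m small \<epsilon>, of G] by auto
  have "\<exists>A. finite A \<and> psum q A \<le> x \<and> x < psum q A + \<epsilon>" if x: "psum q A0 \<le> x" for x
  proof -
    define y where "y = x - psum q A0"
    obtain K where K: "y - G < q ^ K" using q real_arch_pow by blast
    obtain k where k: "k \<in> T" "K \<le> k" using T(2) by (meson infinite_nat_iff_unbounded_le)
    have "q ^ K \<le> q ^ k" using q k by simp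
    also have "q ^ k = psum q {k}" by (simp add: psum_def)
    also have "\<dots> \<le> psum q (T \<inter> {..<Suc k})" using q k by (intro psum_mono) auto
    finally have "y < G + psum q (T \<inter> {..<Suc k})" using K by simp
    then obtain B where B: "B \<subseteq> T \<inter> {..<Suc k}" "psum q B \<le> y" "y < psum q B + G"
      using greedy_psum[of T q G y "Suc k"] T(3) x by (auto simp: y_def)
    obtain A where A: "A \<in> \<U>" "psum q A - psum q A0 \<le> y - psum q B" "y - psum q B < psum q A - psum q A0 + \<epsilon>"
      using \<U>(3)[rule_format, of "y - psum q B"] B(2,3) by auto
    have fin: "finite A" "finite B" using A(1) \<U>(1) B(1) by (auto intro: finite_subset)
    moreover have "A \<inter> B = {}" using A(1) \<U>(1) B(1) T(1) by blast
    ultimately have "psum q (A \<union> B) = psum q A + psum q B" by (intro psum_Un)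
    then show ?thesis using A fin by (intro exI[of _ "A \<union> B"]) (auto simp: y_def)
  qed
  then show "\<exists>x0. \<forall>x\<ge>x0. \<exists>A. finite A \<and> psum q A \<le> x \<and> x < psum q A + \<epsilon>" by blast
qed

text \<open>Even exponents are sums at \<open>q\<^sup>2\<close> and supply the small differences.
  Odd exponents have bounded gaps because their ratio \<open>q\<^sup>2\<close> is below
  \<open>2\<close>.\<close>

lemma Lgap_eq_0_if_small_square:
  assumes q: "1 < q" "q\<^sup>2 < 2" and small: "small_differences (q\<^sup>2) UNIV"
  shows "Lgap q = 0"
proof (rule Lgap_eq_0_if_split[OF q(1), of 2 "{k. even k}" "{k. odd k}" q])
  show "small_differences q {k. even k}"
    unfolding small_differences_def
  proof (intro allI impI)
    fix \<epsilon> :: real assume "0 < \<epsilon>"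
    then obtain A B where AB: "finite A" "finite B" "psum (q\<^sup>2) A < psum (q\<^sup>2) B" "psum (q\<^sup>2) B - psum (q\<^sup>2) A < \<epsilon>"
      using small unfolding small_differences_def by meson
    then show "\<exists>A B. finite A \<and> finite B \<and> A \<subseteq> {k. even k} \<and> B \<subseteq> {k. even k} \<and>
        psum q A < psum q B \<and> psum q B - psum q A < \<epsilon>"
      by (intro exI[of _ "(*) 2 ` A"] exI[of _ "(*) 2 ` B"]) (auto simp: psum_scale)
  qed
  have "infinite (range (\<lambda>n::nat. 2 * n + 1))" by (intro range_inj_infinite) (auto simp: inj_def)
  then show "infinite {k::nat. odd k}" by (rule infinite_super[rotated]) auto
  show "q ^ k \<le> q + psum q ({k. odd k} \<inter> {..<k})" if k: "k \<in> {k. odd k}" for k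
  proof -
    obtain j where j: "k = 2 * j + 1" using k unfolding mem_Collect_eq by (rule oddE)
    have "(+) 1 ` (*) 2 ` {..<j} \<subseteq> {k. odd k} \<inter> {..<k}" by (auto simp: j)
    then have "psum q ((+) 1 ` (*) 2 ` {..<j}) \<le> psum q ({k. odd k} \<inter> {..<k})"
      using q by (intro psum_mono) auto
    moreover have "psum q ((+) 1 ` (*) 2 ` {..<j}) = q * psum (q\<^sup>2) {..<j}"
      by (simp only: psum_shift psum_scale power_one_right zero_less_numeral)
    moreover have "(q\<^sup>2) ^ j - 1 \<le> psum (q\<^sup>2) {..<j}"
    proof -
      have r: "1 < q\<^sup>2" using q by simp
      then have "(q\<^sup>2) ^ j - 1 \<le> ((q\<^sup>2) ^ j - 1) / (q\<^sup>2 - 1)"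
        using q(2) by (simp add: pos_le_divide_eq mult_left_le one_le_power)
      then show ?thesis using r by (simp add: psum_lessThan)
    qed
    then have "q * ((q\<^sup>2) ^ j - 1) \<le> q * psum (q\<^sup>2) {..<j}" using q by (intro mult_left_mono) auto
    moreover have "q ^ k = q + q * ((q\<^sup>2) ^ j - 1)" by (simp add: j power_mult[symmetric] algebra_simps)
    ultimately show ?thesis by linarith
  qed
qed auto

section \<open>The case where the square is the golden ratio\<close>

lemma psum_less_if_first_difference:
  fixes x :: real
  assumes x: "0 < x" "x < 1 / 2" and fin: "finite A" "finite B"
    and k: "k \<in> A" "k \<notin> B" "A \<inter> {..<k} = B \<inter> {..<k}"
  shows "psum x B < psum x A"
proof -
  obtain N where N: "B \<subseteq> {..<N}" using fin finite_nat_bounded by blast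
  have "B \<subseteq> (B \<inter> {..<k}) \<union> (+) (Suc k) ` {..<N}"
  proof
    fix j assume j: "j \<in> B"
    then have "j \<noteq> k" "j < N" using k(2) N by blast+
    then show "j \<in> (B \<inter> {..<k}) \<union> (+) (Suc k) ` {..<N}"
      using j by (cases "j < k") (auto intro!: image_eqI[of _ _ "j - Suc k"])
  qed
  then have "psum x B \<le> psum x ((B \<inter> {..<k}) \<union> (+) (Suc k) ` {..<N})"
    using x by (intro psum_mono) auto
  also have "\<dots> = psum x (B \<inter> {..<k}) + x ^ Suc k * psum x {..<N}"
    unfolding psum_shift[symmetric] by (rule psum_Un) auto
  \<comment> \<open>As \<open>x < 1 / 2\<close>, all later powers together stay below the power at
    the first difference.\<close>
  also have "x ^ Suc k * psum x {..<N} < x ^ k"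
  proof -
    have "psum x {..<N} = (1 - x ^ N) / (1 - x)"
      using x by (simp add: psum_lessThan minus_divide_divide[symmetric, of "x ^ N - 1"])
    also have "\<dots> \<le> 1 / (1 - x)" using x by (intro divide_right_mono) auto
    also have "\<dots> < 2" using x by (simp add: pos_divide_less_eq)
    finally have "x * psum x {..<N} < x * 2" using x by (intro mult_strict_left_mono) auto
    then have "x * psum x {..<N} < 1" using x by linarith
    then have "x ^ k * (x * psum x {..<N}) < x ^ k * 1" using x by (intro mult_strict_left_mono) auto
    then show ?thesis by (simp add: mult_ac)
  qed
  also have "psum x (B \<inter> {..<k}) + x ^ k = psum x (insert k (A \<inter> {..<k}))"
    using k(3) by (subst psum_insert) auto
  also have "\<dots> \<le> psum x A" using x fin k by (intro psum_mono) auto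
  finally show ?thesis by simp
qed

lemma psum_inj:
  fixes x :: real
  assumes x: "0 < x" "x < 1 / 2" and fin: "finite A" "finite B" and eq: "psum x A = psum x B"
  shows "A = B"
proof (rule ccontr)
  assume "A \<noteq> B"
  define k where "k = (LEAST k. (k \<in> A) \<noteq> (k \<in> B))"
  have ex: "\<exists>k. (k \<in> A) \<noteq> (k \<in> B)" using \<open>A \<noteq> B\<close> by blast
  then have k: "(k \<in> A) \<noteq> (k \<in> B)" unfolding k_def by (rule LeastI_ex)
  have "A \<inter> {..<k} = B \<inter> {..<k}" unfolding k_def using not_less_Least by blast
  then show False
    using k psum_less_if_first_difference[OF x fin, of k] psum_less_if_first_difference[OF x fin(2,1), of k] eq
    by auto
qed

lemma psum_mod4:
  assumes "finite A" "A \<subseteq> {k. k mod 4 \<in> {0, 1}}"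
  shows "psum z A = psum (z ^ 4) {j. 4 * j \<in> A} + z * psum (z ^ 4) {j. 4 * j + 1 \<in> A}"
    and "finite {j. 4 * j \<in> A}" "finite {j. 4 * j + 1 \<in> A}"
    and "A = (*) 4 ` {j. 4 * j \<in> A} \<union> (+) 1 ` (*) 4 ` {j. 4 * j + 1 \<in> A}"
proof -
  have inj: "inj ((*) (4::nat))" "inj (\<lambda>j::nat. 4 * j + 1)" by (auto simp: inj_def)
  show fin: "finite {j. 4 * j \<in> A}" "finite {j. 4 * j + 1 \<in> A}"
    using finite_vimageI[OF assms(1) inj(1)] finite_vimageI[OF assms(1) inj(2)] by (auto simp: vimage_def)
  show A: "A = (*) 4 ` {j. 4 * j \<in> A} \<union> (+) 1 ` (*) 4 ` {j. 4 * j + 1 \<in> A}"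
  proof (intro equalityI subsetI)
    fix k assume k: "k \<in> A"
    then consider "k mod 4 = 0" | "k mod 4 = 1" using assms(2) by auto
    then show "k \<in> (*) 4 ` {j. 4 * j \<in> A} \<union> (+) 1 ` (*) 4 ` {j. 4 * j + 1 \<in> A}"
    proof cases
      case 1
      then have "k = 4 * (k div 4)" by presburger
      then show ?thesis using k by (metis (mono_tags, lifting) UnI1 image_eqI mem_Collect_eq)
    next
      case 2
      then have "k = 1 + 4 * (k div 4)" by presburger
      then show ?thesis using k by (metis (mono_tags, lifting) UnI2 add.commute image_eqI mem_Collect_eq)
    qed
  qed auto
  have "psum z ((*) 4 ` {j. 4 * j \<in> A} \<union> (+) 1 ` (*) 4 ` {j. 4 * j + 1 \<in> A}) =
      psum (z ^ 4) {j. 4 * j \<in> A} + z * psum (z ^ 4) {j. 4 * j + 1 \<in> A}"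
  proof (subst psum_Un)
    show "(*) 4 ` {j. 4 * j \<in> A} \<inter> (+) 1 ` (*) 4 ` {j. 4 * j + 1 \<in> A} = {}"
      by (auto; presburger)
  qed (use fin in \<open>auto simp only: psum_shift psum_scale power_one_right zero_less_numeral finite_imageI\<close>)
  then show "psum z A = psum (z ^ 4) {j. 4 * j \<in> A} + z * psum (z ^ 4) {j. 4 * j + 1 \<in> A}"
    using A by simp
qed

text \<open>Counting: \<open>\<alpha>\<close> is purely imaginary and \<open>\<alpha> ^ 4\<close> is
  a real number below \<open>1 / 2\<close>, so sums at \<open>\<alpha>\<close>, and hence those at
  \<open>q\<close>, determine their exponents in \<open>?S\<close>. This gives \<open>4 ^ n\<close>
  distinct sums in an interval whose length grows only like \<open>3 ^ n\<close>.\<close>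

lemma small_differences_golden:
  assumes q: "1 < q" "q ^ 4 = q\<^sup>2 + 1" "q\<^sup>2 < 2"
    and \<alpha>: "conj_to q \<alpha>" "\<alpha>\<^sup>2 = of_real (- (1 / q\<^sup>2))"
  shows "small_differences q {k. k mod 4 \<in> {0, 1}}"
proof (rule ccontr)
  let ?S = "{k::nat. k mod 4 \<in> {0, 1}}"
  assume "\<not> ?thesis"
  then obtain \<epsilon> where \<epsilon>: "0 < \<epsilon>" and sep: "\<And>A B. finite A \<Longrightarrow> finite B \<Longrightarrow> A \<subseteq> ?S \<Longrightarrow> B \<subseteq> ?S \<Longrightarrow>
      psum q A < psum q B \<Longrightarrow> \<epsilon> \<le> psum q B - psum q A"
    unfolding small_differences_def by (meson not_less)
  define x where "x = 1 / q ^ 4"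
  have q2: "1 < q\<^sup>2" using q(1) by simp
  have "2 < q ^ 4" using q(2) q2 by simp
  then have x: "0 < x" "x < 1 / 2" using q(1) by (auto simp: x_def intro!: divide_strict_left_mono)
  have \<alpha>4: "\<alpha> ^ 4 = of_real x"
  proof -
    have "\<alpha> ^ 4 = (\<alpha>\<^sup>2)\<^sup>2" by simp
    also have "\<dots> = of_real ((- (1 / q\<^sup>2))\<^sup>2)" unfolding \<alpha>(2) by (rule of_real_power[symmetric])
    also have "(- (1 / q\<^sup>2))\<^sup>2 = x" by (simp add: x_def power_one_over)
    finally show ?thesis .
  qed
  have Re: "Re \<alpha> = 0" and Im: "Im \<alpha> \<noteq> 0"
  proof -
    have e1: "(Re \<alpha>)\<^sup>2 - (Im \<alpha>)\<^sup>2 = - (1 / q\<^sup>2)" using arg_cong[OF \<alpha>(2), of Re] by (simp add: Re_power2)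
    have e2: "Re \<alpha> * Im \<alpha> = 0" using arg_cong[OF \<alpha>(2), of Im] by (simp add: Im_power2)
    have "0 < 1 / q\<^sup>2" using q by simp
    then show "Im \<alpha> \<noteq> 0" using e1 by (smt (verit) zero_le_power2 zero_power2)
    then show "Re \<alpha> = 0" using e2 by simp
  qed
  have inj: "A = B" if A: "finite A" "A \<subseteq> ?S" and B: "finite B" "B \<subseteq> ?S" and eq: "psum q A = psum q B" for A B
  proof -
    have of_real: "psum (of_real x) C = complex_of_real (psum x C)" for C by (simp add: psum_def)
    have "psum \<alpha> A = psum \<alpha> B" using \<alpha>(1) eq by (rule conj_to_psum_eq)
    then have e: "of_real (psum x {j. 4 * j \<in> A}) + \<alpha> * of_real (psum x {j. 4 * j + 1 \<in> A}) =
        of_real (psum x {j. 4 * j \<in> B}) + \<alpha> * of_real (psum x {j. 4 * j + 1 \<in> B})"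
      using psum_mod4(1)[OF A, of \<alpha>] psum_mod4(1)[OF B, of \<alpha>] by (simp only: \<alpha>4 of_real)
    \<comment> \<open>The real part isolates the exponents \<open>0\<close> modulo \<open>4\<close>,
      the imaginary part those that are \<open>1\<close> modulo \<open>4\<close>.\<close>
    have "psum x {j. 4 * j \<in> A} = psum x {j. 4 * j \<in> B}" using arg_cong[OF e, of Re] Re by simp
    then have 0: "{j. 4 * j \<in> A} = {j. 4 * j \<in> B}"
      using psum_mod4(2)[OF A] psum_mod4(2)[OF B] by (intro psum_inj[OF x])
    have "psum x {j. 4 * j + 1 \<in> A} = psum x {j. 4 * j + 1 \<in> B}" using arg_cong[OF e, of Im] Im by simp
    then have 1: "{j. 4 * j + 1 \<in> A} = {j. 4 * j + 1 \<in> B}"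
      using psum_mod4(3)[OF A] psum_mod4(3)[OF B] by (intro psum_inj[OF x])
    show ?thesis using psum_mod4(4)[OF A] psum_mod4(4)[OF B] unfolding 0 1 by (rule trans[OF _ sym])
  qed
  define C where "C = 1 / (q - 1) / \<epsilon>"
  obtain n where n: "C + 1 < (4 / 3) ^ n" using real_arch_pow[of "4 / 3" "C + 1"] by auto
  define D where "D = (*) 4 ` {..<n} \<union> (+) 1 ` (*) 4 ` {..<n}"
  have D: "finite D" "D \<subseteq> ?S" "D \<subseteq> {..<4 * n}" by (auto simp: D_def mod_Suc)
  have "card ((*) 4 ` {..<n}) = n" "card ((+) 1 ` (*) 4 ` {..<n}) = n"
    by (simp_all add: card_image inj_on_def image_image)
  moreover have "(*) 4 ` {..<n} \<inter> (+) 1 ` (*) 4 ` {..<n} = {}" by (auto; presburger)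
  ultimately have "card D = 2 * n" unfolding D_def by (subst card_Un_disjoint) auto
  then have "card (Pow D) = 4 ^ n" using D(1) by (simp add: card_Pow power_mult)
  moreover have "inj_on (psum q) (Pow D)"
    using D by (intro inj_onI inj) (auto intro: finite_subset)
  ultimately have card: "card (psum q ` Pow D) = 4 ^ n" by (simp add: card_image)
  \<comment> \<open>A block of four exponents scales the range by
    \<open>q ^ 4 = q\<^sup>2 + 1 < 3\<close> but offers four choices.\<close>
  have R: "psum q {..<4 * n} \<le> 3 ^ n / (q - 1)"
  proof -
    have "q ^ (4 * n) \<le> 3 ^ n" unfolding power_mult using q by (intro power_mono) auto
    then show ?thesis using q(1) by (simp add: psum_lessThan divide_right_mono)
  qed
  have "real (card (psum q ` Pow D)) \<le> (3 ^ n / (q - 1)) / \<epsilon> + 1"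
  proof (rule separated_card_le[OF \<epsilon>, where a = 0])
    show "psum q ` Pow D \<subseteq> {0..0 + 3 ^ n / (q - 1)}"
    proof (rule image_subsetI)
      fix A assume "A \<in> Pow D"
      then have "psum q A \<le> psum q {..<4 * n}" using D q(1) by (intro psum_mono) auto
      then show "psum q A \<in> {0..0 + 3 ^ n / (q - 1)}" using R psum_nonneg[of q A] q(1) by simp
    qed
    show "\<epsilon> \<le> v - u" if uv: "u \<in> psum q ` Pow D" "v \<in> psum q ` Pow D" "u < v" for u v
    proof -
      obtain A B where "A \<subseteq> D" "B \<subseteq> D" "u = psum q A" "v = psum q B" using uv by blast
      then show ?thesis using sep[of A B] uv(3) D by (auto intro: finite_subset)
    qed
  qed (use D q(1) in auto)
  then have "4 ^ n \<le> C * 3 ^ n + 1" using card by (simp add: C_def)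
  also have "\<dots> \<le> (C + 1) * 3 ^ n" by (simp add: distrib_right)
  also have "\<dots> < (4 / 3) ^ n * 3 ^ n" using n by (intro mult_strict_right_mono) auto
  also have "\<dots> = 4 ^ n" by (simp add: power_mult_distrib[symmetric])
  finally show False by simp
qed

text \<open>Residues \<open>2\<close> and \<open>3\<close> modulo \<open>4\<close> serve as the
  coarse exponents. Since \<open>q\<^sup>2 = q ^ 4 - 1\<close>, their sums telescope in blocks with
  gap \<open>1 + q\<close>, and \<open>q ^ 3 \<le> 1 + q\<close> covers the positions inside a
  block.\<close>

lemma Lgap_eq_0_golden:
  assumes q: "1 < q" "q ^ 4 = q\<^sup>2 + 1" "q\<^sup>2 < 2"
    and \<alpha>: "conj_to q \<alpha>" "\<alpha>\<^sup>2 = of_real (- (1 / q\<^sup>2))"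
  shows "Lgap q = 0"
proof (rule Lgap_eq_0_if_split[OF q(1), of 4 "{k. k mod 4 \<in> {0, 1}}" "{k. k mod 4 \<in> {2, 3}}" "1 + q"])
  let ?T = "{k::nat. k mod 4 \<in> {2, 3}}"
  show "small_differences q {k. k mod 4 \<in> {0, 1}}" using assms by (rule small_differences_golden)
  have "infinite (range (\<lambda>n::nat. 4 * n + 2))" by (intro range_inj_infinite) (auto simp: inj_def)
  then show "infinite ?T" by (rule infinite_super[rotated]) (auto simp: mod_Suc)
  have sum: "1 + q + psum q (?T \<inter> {..<4 * j}) = (1 + q) * q ^ (4 * j)" for j
  proof (induction j)
    case (Suc j)
    have "?T \<inter> {..<4 * Suc j} = (?T \<inter> {..<4 * j}) \<union> {4 * j + 2, 4 * j + 3}"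
    proof (intro equalityI subsetI)
      fix k assume "k \<in> ?T \<inter> {..<4 * Suc j}"
      then show "k \<in> (?T \<inter> {..<4 * j}) \<union> {4 * j + 2, 4 * j + 3}"
        by (simp; presburger)
    qed (auto simp: mod_Suc)
    then have "psum q (?T \<inter> {..<4 * Suc j}) = psum q (?T \<inter> {..<4 * j}) + psum q {4 * j + 2, 4 * j + 3}"
      by (simp only:) (rule psum_Un; auto)
    also have "psum q {4 * j + 2, 4 * j + 3} = q ^ (4 * j) * (q\<^sup>2 + q ^ 3)"
      by (simp add: psum_def power_add distrib_left power2_eq_square)
    also have "q\<^sup>2 + q ^ 3 = (1 + q) * (q ^ 4 - 1)"
      unfolding q(2) by (simp add: algebra_simps power2_eq_square power3_eq_cube)
    finally have "1 + q + psum q (?T \<inter> {..<4 * Suc j}) = (1 + q) * q ^ (4 * j) + q ^ (4 * j) * ((1 + q) * (q ^ 4 - 1))"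
      using Suc by simp
    also have "\<dots> = (1 + q) * (q ^ (4 * j) * q ^ 4)" by (simp add: algebra_simps)
    also have "q ^ (4 * j) * q ^ 4 = q ^ (4 * Suc j)" by (simp add: power_add[symmetric] add.commute)
    finally show ?case .
  qed simp
  show "q ^ k \<le> 1 + q + psum q (?T \<inter> {..<k})" if k: "k \<in> ?T" for k
  proof -
    define j i where "j = k div 4" and "i = k mod 4"
    have i: "k = 4 * j + i" "i = 2 \<or> i = 3" using k by (auto simp: j_def i_def)
    have "q * q ^ 3 = q * q + 1" using q(2) by (simp add: power2_eq_square eval_nat_numeral)
    also have "\<dots> \<le> q * (1 + q)" using q(1) by (simp add: algebra_simps)
    finally have q3: "q ^ 3 \<le> 1 + q" using q(1) by simp
    have "q ^ i \<le> q ^ 3" using i q(1) by (intro power_increasing) auto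
    then have "q ^ i \<le> 1 + q" using q3 by linarith
    then have "q ^ (4 * j) * q ^ i \<le> q ^ (4 * j) * (1 + q)" using q(1) by (intro mult_left_mono) auto
    then have "q ^ k \<le> 1 + q + psum q (?T \<inter> {..<4 * j})" unfolding sum by (simp add: i power_add mult.commute)
    moreover have "psum q (?T \<inter> {..<4 * j}) \<le> psum q (?T \<inter> {..<k})" using q(1) i by (intro psum_mono) auto
    ultimately show ?thesis by linarith
  qed
qed auto

lemma small_differences_if_large_conj:
  assumes "1 < b" "b < 2" "unit_root b" "conj_to b z" "z \<noteq> of_real b" "1 < cmod z"
  shows "small_differences b UNIV"
proof -
  obtain p where "min_int_poly b p" using assms(3) by (rule unit_root_min_int_poly)
  then interpret min_int_poly b p .
  show ?thesis unfolding small_differences_def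
    using small_psum_difference[OF assms(1,2,4,6,5)] ipoly_rat_imp_int by simp
qed

text \<open>The hypotheses are tested on \<open>q\<^sup>2\<close> and its conjugate
  \<open>\<alpha>\<^sup>2\<close>. Without a second large conjugate of \<open>q\<^sup>2\<close>,
  \<open>\<alpha>\<close> is not real but \<open>\<alpha>\<^sup>2\<close> is, so
  \<open>\<alpha>\<^sup>2 = - 1 / q\<^sup>2\<close> and the golden ratio case applies.\<close>

lemma Lgap_eq_0_if_small_conj:
  assumes q: "1 < q" "q\<^sup>2 < 2" "unit_root q" and \<alpha>: "conj_to q \<alpha>"
    and small: "cmod \<alpha> * q < 1 \<or> (\<alpha> \<notin> \<real> \<and> cmod \<alpha> * q = 1)"
  shows "Lgap q = 0"
proof (cases "\<exists>z. conj_to (q\<^sup>2) z \<and> z \<noteq> of_real (q\<^sup>2) \<and> 1 < cmod z")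
  case True
  then obtain z where "conj_to (q\<^sup>2) z" "z \<noteq> of_real (q\<^sup>2)" "1 < cmod z" by blast
  then have "small_differences (q\<^sup>2) UNIV"
    using q unit_root_square[OF q(3)] by (intro small_differences_if_large_conj[of _ z]) auto
  then show ?thesis using q by (intro Lgap_eq_0_if_small_square)
next
  case False
  have r: "1 < q\<^sup>2" "unit_root (q\<^sup>2)" "conj_to (q\<^sup>2) (\<alpha>\<^sup>2)"
    using q unit_root_square[OF q(3)] conj_to_power[OF \<alpha>] by auto
  have sq: "cmod (\<alpha>\<^sup>2) * q\<^sup>2 = (cmod \<alpha> * q)\<^sup>2" by (simp add: norm_power power_mult_distrib)
  have "\<not> (cmod (\<alpha>\<^sup>2) * q\<^sup>2 < 1 \<or> (\<alpha>\<^sup>2 \<notin> \<real> \<and> cmod (\<alpha>\<^sup>2) * q\<^sup>2 = 1))"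
    using ex_large_conj_if_small_conj[OF r(1) q(2) r(2,3)] False by blast
  moreover have "(cmod \<alpha> * q)\<^sup>2 < 1" if "cmod \<alpha> * q < 1"
    using that q(1) by (simp add: power_less_one_iff)
  ultimately have a: "cmod \<alpha> * q = 1" "\<alpha> \<notin> \<real>" "\<alpha>\<^sup>2 \<in> \<real>" using small unfolding sq by auto
  then have "Re \<alpha> = 0" by (auto simp: complex_is_Real_iff Im_power2)
  then have "\<alpha>\<^sup>2 = of_real (- ((cmod \<alpha>)\<^sup>2))" by (simp add: complex_eq_iff cmod_power2 Re_power2 Im_power2)
  moreover have "cmod \<alpha> = 1 / q" using a(1) q(1) by (simp add: field_simps)
  ultimately have \<alpha>2: "\<alpha>\<^sup>2 = of_real (- (1 / q\<^sup>2))" by (simp add: power_one_over)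
  have "(q\<^sup>2)\<^sup>2 = q\<^sup>2 + 1"
  proof (rule golden_if_no_large_conj[OF r(1) q(2) r(2)])
    show "conj_to (q\<^sup>2) (of_real (- 1 / q\<^sup>2))" using r(3) unfolding \<alpha>2 by simp
    show "cmod z \<le> 1" if "conj_to (q\<^sup>2) z" "z \<noteq> of_real (q\<^sup>2)" for z using that False by force
  qed
  then show ?thesis using q \<alpha> \<alpha>2 by (intro Lgap_eq_0_golden) auto
qed

theorem theorem2p4:
  fixes q :: real
  assumes "1 < q" and "q < 2"
    and "\<exists>P :: int poly. P \<noteq> 0 \<and> (\<forall>i. coeff P i \<in> {-1, 0, 1}) \<and> poly (map_poly of_int P) q = 0"
  shows "((\<exists>\<alpha>\<in>conjugates q. cmod \<alpha> * q < 1) \<longrightarrow> lgap q = 0 \<and> closure (Lam q) = UNIV) \<and>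
    ((\<exists>\<alpha>\<in>conjugates q. \<alpha> \<notin> \<real> \<and> cmod \<alpha> * q = 1) \<longrightarrow> lgap q = 0) \<and>
    (((\<exists>\<alpha>\<in>conjugates q. cmod \<alpha> * q < 1) \<or> (\<exists>\<alpha>\<in>conjugates q. \<alpha> \<notin> \<real> \<and> cmod \<alpha> * q = 1)) \<and>
       q < sqrt 2 \<longrightarrow> Lgap q = 0)"
proof -
  have unit: "unit_root q" using assms unit_root_if_littlewood by force
  have main: "small_differences q UNIV \<and> (q < sqrt 2 \<longrightarrow> Lgap q = 0)"
    if \<alpha>: "\<alpha> \<in> conjugates q" "cmod \<alpha> * q < 1 \<or> (\<alpha> \<notin> \<real> \<and> cmod \<alpha> * q = 1)" for \<alpha>
  proof (intro conjI impI)
    have conj: "conj_to q \<alpha>" using unit \<alpha>(1) by (rule conj_to_if_conjugates)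
    show "small_differences q UNIV"
      using ex_large_conj_if_small_conj[OF assms(1,2) unit conj \<alpha>(2)]
        small_differences_if_large_conj[OF assms(1,2) unit] by blast
    assume "q < sqrt 2"
    then have "q\<^sup>2 < 2" using assms(1) power_strict_mono[of q "sqrt 2" 2] by simp
    then show "Lgap q = 0" using assms(1) unit conj \<alpha>(2) by (intro Lgap_eq_0_if_small_conj)
  qed
  have "lgap q = 0" if "small_differences q UNIV"
    using that by (intro lgap_eq_0[OF assms(1)]) (auto simp: small_differences_def)
  then show ?thesis using main Lam_dense[OF assms(1)] by blast
qed

end
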